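(* Let $k$ be a fixed integer. The fuzzy factorization rank and the tropical factorization rank of a $k$-band $n\times n$ matrix can be computed in polynomial time.
   Context: A square matrix $M$ is $k$-band if $M_{ij}=0$ whenever $|i-j|>k$. The tropical semiring is $(\mathbb{R}_+,\max,\cdot)$ (nonnegative reals with addition $\max$ and ordinary multiplication), and the fuzzy algebra is $([0,1],\max,\min)$; in both, $0$ and $1$ are the additive and multiplicative identities. Matrix multiplication over a semiring is defined like ordinary matrix multiplication with $+,\cdot$ replaced by the semiring operations $\oplus,\odot$. The factorization rank of a matrix $A\in S^{m\times n}$ over a semiring $S$ is the smallest integer $r$ for which there exist $B\in S^{m\times r}$ and $C\in S^{r\times n}$ with $B\odot C=A$; by convention the zero matrix has factorization rank $0$. The tropical (resp. fuzzy) factorization rank is the factorization rank over the tropical semiring (resp. fuzzy algebra). *)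

theory Defs
  imports
    "Jordan_Normal_Form.Matrix"
    "HOL-Computational_Algebra.Polynomial"
    "HOL-Library.Log_Nat"
begin

section \<open>The two semirings\<close>

text \<open>The tropical semiring: nonnegative reals with maximum and ordinary multiplication.\<close>

typedef tropical = "{x :: real. 0 \<le> x}"
  morphisms tropical_val Tropical
  by auto

setup_lifting type_definition_tropical

instantiation tropical :: comm_semiring_1
begin

lift_definition zero_tropical :: tropical is 0 by simp
lift_definition one_tropical :: tropical is 1 by simp
lift_definition plus_tropical :: "tropical \<Rightarrow> tropical \<Rightarrow> tropical" is max by simp
lift_definition times_tropical :: "tropical \<Rightarrow> tropical \<Rightarrow> tropical" is "(*)" by simp

instance
  by standard
    (transfer; simp add: max.assoc max.commute mult.assoc mult.commute
      max_mult_distrib_left max_mult_distrib_right)+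

end

text \<open>The fuzzy algebra: the unit interval with maximum and minimum.\<close>

typedef fuzzy = "{0..1 :: real}"
  morphisms fuzzy_val Fuzzy
  by auto

setup_lifting type_definition_fuzzy

instantiation fuzzy :: comm_semiring_1
begin

lift_definition zero_fuzzy :: fuzzy is 0 by simp
lift_definition one_fuzzy :: fuzzy is 1 by simp
lift_definition plus_fuzzy :: "fuzzy \<Rightarrow> fuzzy \<Rightarrow> fuzzy" is max by auto
lift_definition times_fuzzy :: "fuzzy \<Rightarrow> fuzzy \<Rightarrow> fuzzy" is min by auto

instance
  by standard (transfer; auto simp: max_def min_def)+

end


section \<open>Factorization rank and band matrices\<close>

text \<open>The product is the library's matrix product over a semiring; for \<open>r = 0\<close> it is the zero
  matrix, so the convention on the zero matrix is part of the definition.\<close>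

definition factorization_rank :: "'a :: comm_semiring_1 mat \<Rightarrow> nat" where
  "factorization_rank A = (LEAST r. \<exists>B C. B \<in> carrier_mat (dim_row A) r \<and>
     C \<in> carrier_mat r (dim_col A) \<and> B * C = A)"

lemma factorization_rank_zero: "factorization_rank (0\<^sub>m m n :: 'a :: comm_semiring_1 mat) = 0"
proof -
  have "0\<^sub>m m 0 * 0\<^sub>m 0 n = (0\<^sub>m m n :: 'a mat)"
    by simp
  then show ?thesis
    unfolding factorization_rank_def
    by (intro Least_eq_0) (metis index_zero_mat(2,3) zero_carrier_mat)
qed

definition band_matrices :: "int \<Rightarrow> 'a :: zero mat set" where
  "band_matrices k = {A. square_mat A \<and>
     (\<forall>i < dim_row A. \<forall>j < dim_col A. \<bar>int i - int j\<bar> > k \<longrightarrow> A $$ (i, j) = 0)}"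


section \<open>Random access machines over the reals\<close>

text \<open>Programs of a random access machine with two memories: one holds natural numbers and is the
  only source of addresses, the other holds real numbers. Real numbers can be moved, combined by
  the field operations and compared; there is no rounding and there are no real constants besides
  0 and 1. Subtraction of natural numbers is truncated, division by 0 yields 0.\<close>

datatype nexp =
    NConst nat
  | NLoad nexp
  | NAdd nexp nexp
  | NSub nexp nexp
  | NMul nexp nexp

datatype rexp =
    RZero
  | ROne
  | RLoad nexp
  | RAdd rexp rexp
  | RSub rexp rexp
  | RMul rexp rexp
  | RDiv rexp rexp

datatype test =
    NLess nexp nexp
  | RLess rexp rexp
  | TNot test
  | TAnd test test

datatype prog =
    Skip
  | NStore nexp nexp
  | RStore nexp rexp
  | Seq prog prog
  | Cond test prog prog
  | While test prog

type_synonym state = "(nat \<Rightarrow> nat) \<times> (nat \<Rightarrow> real)"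

primrec nval :: "nexp \<Rightarrow> state \<Rightarrow> nat" where
  "nval (NConst c) s = c"
| "nval (NLoad e) s = fst s (nval e s)"
| "nval (NAdd e f) s = nval e s + nval f s"
| "nval (NSub e f) s = nval e s - nval f s"
| "nval (NMul e f) s = nval e s * nval f s"

primrec rval :: "rexp \<Rightarrow> state \<Rightarrow> real" where
  "rval RZero s = 0"
| "rval ROne s = 1"
| "rval (RLoad e) s = snd s (nval e s)"
| "rval (RAdd e f) s = rval e s + rval f s"
| "rval (RSub e f) s = rval e s - rval f s"
| "rval (RMul e f) s = rval e s * rval f s"
| "rval (RDiv e f) s = rval e s / rval f s"

primrec tval :: "test \<Rightarrow> state \<Rightarrow> bool" where
  "tval (NLess e f) s \<longleftrightarrow> nval e s < nval f s"
| "tval (RLess e f) s \<longleftrightarrow> rval e s < rval f s"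
| "tval (TNot b) s \<longleftrightarrow> \<not> tval b s"
| "tval (TAnd b c) s \<longleftrightarrow> tval b s \<and> tval c s"

text \<open>Natural numbers, addresses included, are always charged by their length in binary (the
  logarithmic cost criterion), real numbers by a parameter \<open>sz\<close>. Evaluating an expression costs
  the total size of the values of all its subexpressions.\<close>

definition nat_size :: "nat \<Rightarrow> nat" where
  "nat_size m = Suc (floorlog 2 m)"

primrec ncost :: "nexp \<Rightarrow> state \<Rightarrow> nat" where
  "ncost (NConst c) s = nat_size c"
| "ncost (NLoad e) s = ncost e s + nat_size (nval (NLoad e) s)"
| "ncost (NAdd e f) s = ncost e s + ncost f s + nat_size (nval (NAdd e f) s)"
| "ncost (NSub e f) s = ncost e s + ncost f s + nat_size (nval (NSub e f) s)"
| "ncost (NMul e f) s = ncost e s + ncost f s + nat_size (nval (NMul e f) s)"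

primrec rcost :: "(real \<Rightarrow> nat) \<Rightarrow> rexp \<Rightarrow> state \<Rightarrow> nat" where
  "rcost sz RZero s = sz 0"
| "rcost sz ROne s = sz 1"
| "rcost sz (RLoad e) s = ncost e s + sz (rval (RLoad e) s)"
| "rcost sz (RAdd e f) s = rcost sz e s + rcost sz f s + sz (rval (RAdd e f) s)"
| "rcost sz (RSub e f) s = rcost sz e s + rcost sz f s + sz (rval (RSub e f) s)"
| "rcost sz (RMul e f) s = rcost sz e s + rcost sz f s + sz (rval (RMul e f) s)"
| "rcost sz (RDiv e f) s = rcost sz e s + rcost sz f s + sz (rval (RDiv e f) s)"

primrec tcost :: "(real \<Rightarrow> nat) \<Rightarrow> test \<Rightarrow> state \<Rightarrow> nat" where
  "tcost sz (NLess e f) s = ncost e s + ncost f s + 1"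
| "tcost sz (RLess e f) s = rcost sz e s + rcost sz f s + 1"
| "tcost sz (TNot b) s = tcost sz b s + 1"
| "tcost sz (TAnd b c) s = tcost sz b s + tcost sz c s + 1"

text \<open>\<open>exec sz p s t s'\<close>: started in state \<open>s\<close>, program \<open>p\<close> halts in state \<open>s'\<close> after time \<open>t\<close>.\<close>

inductive exec :: "(real \<Rightarrow> nat) \<Rightarrow> prog \<Rightarrow> state \<Rightarrow> nat \<Rightarrow> state \<Rightarrow> bool"
  for sz :: "real \<Rightarrow> nat" where
  Skip: "exec sz Skip s 1 s"
| NStore: "exec sz (NStore a e) s (ncost a s + ncost e s + 1)
    ((fst s)(nval a s := nval e s), snd s)"
| RStore: "exec sz (RStore a e) s (ncost a s + rcost sz e s + 1)
    (fst s, (snd s)(nval a s := rval e s))"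
| Seq: "exec sz p s t s' \<Longrightarrow> exec sz q s' u s'' \<Longrightarrow> exec sz (Seq p q) s (t + u) s''"
| CondTrue: "tval b s \<Longrightarrow> exec sz p s t s' \<Longrightarrow> exec sz (Cond b p q) s (tcost sz b s + t) s'"
| CondFalse: "\<not> tval b s \<Longrightarrow> exec sz q s t s' \<Longrightarrow> exec sz (Cond b p q) s (tcost sz b s + t) s'"
| WhileFalse: "\<not> tval b s \<Longrightarrow> exec sz (While b p) s (tcost sz b s) s"
| WhileTrue: "tval b s \<Longrightarrow> exec sz p s t s' \<Longrightarrow> exec sz (While b p) s' u s'' \<Longrightarrow>
    exec sz (While b p) s (tcost sz b s + t + u) s''"

inductive_cases exec_SkipE: "exec sz Skip s t s'"
inductive_cases exec_NStoreE: "exec sz (NStore a e) s t s'"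
inductive_cases exec_RStoreE: "exec sz (RStore a e) s t s'"
inductive_cases exec_SeqE: "exec sz (Seq p q) s t s'"
inductive_cases exec_CondE: "exec sz (Cond b p q) s t s'"
inductive_cases exec_WhileE: "exec sz (While b p) s t s'"

lemma exec_deterministic:
  "exec sz p s t s' \<Longrightarrow> exec sz p s u s'' \<Longrightarrow> t = u \<and> s' = s''"
proof (induction arbitrary: u s'' rule: exec.induct)
  case Skip
  then show ?case by (elim exec_SkipE) simp
next
  case NStore
  then show ?case by (elim exec_NStoreE) simp
next
  case RStore
  then show ?case by (elim exec_RStoreE) simp
next
  case Seq
  from Seq.prems show ?case by (rule exec_SeqE) (metis Seq.IH)
next
  case CondTrue
  from CondTrue.prems show ?case by (rule exec_CondE) (metis CondTrue.hyps(1) CondTrue.IH)+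
next
  case CondFalse
  from CondFalse.prems show ?case by (rule exec_CondE) (metis CondFalse.hyps(1) CondFalse.IH)+
next
  case WhileFalse
  from WhileFalse.prems show ?case by (rule exec_WhileE) (metis WhileFalse.hyps)+
next
  case WhileTrue
  from WhileTrue.prems show ?case
    by (rule exec_WhileE) (metis WhileTrue.hyps(1) WhileTrue.IH)+
qed


section \<open>Polynomial time\<close>

text \<open>A square matrix is presented by its order in cell 0 of the first memory and its entries, row
  by row, in the second; all other cells are 0.\<close>

definition input_state :: "real mat \<Rightarrow> state" where
  "input_state A = (let n = dim_row A in
     ((\<lambda>_. 0)(0 := n),
      \<lambda>a. if a < n * n then A $$ (a div n, a mod n) else 0))"

definition mat_size :: "(real \<Rightarrow> nat) \<Rightarrow> real mat \<Rightarrow> nat" where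
  "mat_size sz A = (\<Sum>i < dim_row A. \<Sum>j < dim_col A. sz (A $$ (i, j)))"

text \<open>\<open>val\<close> gives the entries as real numbers. One program and one polynomial serve all matrices
  of \<open>D\<close>, of whatever order; the value is left in cell 0 of the first memory.\<close>

definition poly_time :: "(real \<Rightarrow> nat) \<Rightarrow> ('a \<Rightarrow> real) \<Rightarrow> 'a mat set \<Rightarrow> ('a mat \<Rightarrow> nat) \<Rightarrow> bool" where
  "poly_time sz val D f \<longleftrightarrow> (\<exists>(p :: prog) (q :: nat poly). \<forall>A \<in> D. \<exists>t s.
     exec sz p (input_state (map_mat val A)) t s \<and>
     fst s 0 = f A \<and>
     t \<le> poly q (mat_size sz (map_mat val A)))"

text \<open>The arithmetic model: arbitrary real entries, every operation on real numbers has unit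
  cost. The size of a matrix is its number of entries.\<close>

definition poly_time_arith :: "('a \<Rightarrow> real) \<Rightarrow> 'a mat set \<Rightarrow> ('a mat \<Rightarrow> nat) \<Rightarrow> bool" where
  "poly_time_arith val D f \<longleftrightarrow> poly_time (\<lambda>_. 1) val D f"

text \<open>The bit model: rational entries, and a rational number is charged by the length in binary of
  its reduced fraction. Up to a polynomial this is time on a Turing machine. (On irrational numbers
  the value of \<open>rat_size\<close> is meaningless; they do not occur in a computation with rational
  input.)\<close>

definition rat_size :: "real \<Rightarrow> nat" where
  "rat_size x = (case quotient_of (THE r. real_of_rat r = x) of
     (a, b) \<Rightarrow> nat_size (nat \<bar>a\<bar>) + nat_size (nat b))"

definition poly_time_bit :: "('a \<Rightarrow> real) \<Rightarrow> 'a mat set \<Rightarrow> ('a mat \<Rightarrow> nat) \<Rightarrow> bool" where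
  "poly_time_bit val D f \<longleftrightarrow>
     poly_time rat_size val {A \<in> D. elements_mat (map_mat val A) \<subseteq> \<rat>} f"

end

theory Submission
  imports Defs "HOL-Library.Nat_Bijection"
begin

text \<open>Both semirings are selective (\<open>x + y\<close> is \<open>x\<close> or \<open>y\<close>), so a factorization of \<open>A\<close> with inner
  dimension \<open>r\<close> is a cover of the support of \<open>A\<close> by \<open>r\<close> sets each of which is attained by one rank-one
  matrix below \<open>A\<close>. Such a set spans a rectangle inside the support, so in a \<open>k\<close>-band matrix it lies in
  a square window of side \<open>2 * k + 1\<close> at its first row. Whether a subset of a window is attained is
  decided by a fixed number of comparisons: by \<open>min (A i j) (A i' j') \<le> A i j'\<close> in the fuzzy case, and
  in the tropical case by the condition that no cycle has weight less than 1, which is the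
  condition for the existence of a potential. A dynamic program running from the last row to the
  first, whose states are the already covered parts of a window, then finds the least cover. As \<open>k\<close>
  is fixed, the program has a single loop, over the rows, and its body is a loop-free program
  of constant length.\<close>

section \<open>Selective semirings and good sets\<close>

text \<open>In the bit model the danger is that numbers grow from row to row. No real number is ever
  stored: each test compares products of boundedly many input entries, which is why goodness over
  the tropical semiring is expressed by products along cycles, without quotients or logarithms.
  Between rounds the natural numbers in memory never exceed \<open>(2 * K + 1) * n\<close>, because
  covering each row by singletons is always allowed; so the size bound is restored at every row and
  does not compound. The program text runs through all families of subsets of a window, which is
  enormous in \<open>K\<close> but independent of the matrix. The recursion is proved for an
  abstract predicate of good sets and the time bound for an abstract size of reals, so that the four
  claims share one argument.\<close>

class selective_semiring = comm_semiring_1 + semiring_no_zero_divisors +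
  assumes add_selective: "x + y = x \<or> x + y = y"

lemma add_idem: "x + x = (x :: 'a :: selective_semiring)"
  using add_selective[of x x] by simp

lemma sum_selective:
  fixes f :: "'b \<Rightarrow> 'a :: selective_semiring"
  assumes "finite I" "sum f I \<noteq> 0"
  shows "\<exists>l\<in>I. f l = sum f I"
  using assms
proof (induction I)
  case (insert x F)
  then show ?case
    using add_selective[of "f x" "sum f F"] by auto
qed simp

lemma sum_absorb:
  fixes f :: "'b \<Rightarrow> 'a :: selective_semiring"
  assumes "finite I" "l \<in> I"
  shows "f l + sum f I = sum f I"
  using assms by (simp add: sum.remove add.assoc[symmetric] add_idem)

text \<open>A sum is a supremum in the order of the semiring: the hypotheses make \<open>a\<close>
  an upper bound of the summands that is attained unless it is 0.\<close>

lemma sum_eqI_selective: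
  fixes f :: "'b \<Rightarrow> 'a :: selective_semiring"
  assumes "finite I" "\<And>l. l \<in> I \<Longrightarrow> f l + a = a" "a \<noteq> 0 \<Longrightarrow> \<exists>l\<in>I. f l = a"
  shows "sum f I = a"
proof -
  have le: "sum f J + a = a" if "finite J" "J \<subseteq> I" for J
    using that
    by (induction J) (auto simp: add.assoc assms(2))
  show ?thesis
  proof (cases "a = 0")
    case True
    then show ?thesis using le[of I] assms(1) by simp
  next
    case False
    then obtain l where "l \<in> I" "f l = a" using assms(3) by blast
    then show ?thesis
      using sum_absorb[OF assms(1), of l f] le[of I] assms(1) by (simp add: add.commute)
  qed
qed

text \<open>The order of a selective semiring is \<open>x \<le> y \<longleftrightarrow> x + y = y\<close>: a good set is a set of nonzero
  entries that a single rank-one matrix below \<open>e\<close> attains simultaneously.\<close>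

definition good :: "(nat \<Rightarrow> nat \<Rightarrow> 'a :: selective_semiring) \<Rightarrow> (nat \<times> nat) set \<Rightarrow> bool" where
  "good e T \<longleftrightarrow> (\<forall>(i, j)\<in>T. e i j \<noteq> 0) \<and>
     (\<exists>b c. (\<forall>i j. b i * c j + e i j = e i j) \<and> (\<forall>(i, j)\<in>T. b i * c j = e i j))"

lemma goodE:
  assumes "good e T"
  obtains b c where "\<And>i j. b i * c j + e i j = e i j"
    "\<And>i j. (i, j) \<in> T \<Longrightarrow> b i * c j = e i j" "\<And>i j. (i, j) \<in> T \<Longrightarrow> e i j \<noteq> 0"
  using assms unfolding good_def by blast

lemma goodI:
  assumes "\<And>i j. b i * c j + e i j = e i j"
    "\<And>i j. (i, j) \<in> T \<Longrightarrow> b i * c j = e i j" "\<And>i j. (i, j) \<in> T \<Longrightarrow> e i j \<noteq> 0"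
  shows "good e T"
  using assms unfolding good_def by blast

lemma good_empty: "good e {}"
  by (rule goodI[of "\<lambda>_. 0" "\<lambda>_. 0"]) auto

lemma good_singleton:
  assumes "e i j \<noteq> 0"
  shows "good e {(i, j)}"
  by (rule goodI[of "\<lambda>i'. if i' = i then e i j else 0" "\<lambda>j'. if j' = j then 1 else 0"])
    (use assms in \<open>auto simp: add_idem\<close>)

text \<open>Without zero divisors the nonzero pattern of a rank-one matrix is a product set, and a
  matrix that dominates it is nonzero there.\<close>

lemma good_rectangle:
  assumes "good e T" "(i, j) \<in> T" "(i', j') \<in> T"
  shows "e i j' \<noteq> 0"
proof
  assume 0: "e i j' = 0"
  from assms(1) obtain b c where bc: "\<And>i j. b i * c j + e i j = e i j"
    "\<And>i j. (i, j) \<in> T \<Longrightarrow> b i * c j = e i j" "\<And>i j. (i, j) \<in> T \<Longrightarrow> e i j \<noteq> 0"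
    by (rule goodE) (rule that)
  have "b i * c j' = 0" using bc(1)[of i j'] 0 by simp
  moreover have "b i * c j \<noteq> 0" "b i' * c j' \<noteq> 0" using bc(2,3) assms(2,3) by auto
  ultimately show False by auto
qed

section \<open>Translation of good sets\<close>

definition translate :: "nat \<Rightarrow> (nat \<times> nat) set \<Rightarrow> (nat \<times> nat) set" where
  "translate p T = (\<lambda>(a, b). (p + a, p + b)) ` T"

lemma mem_translate: "(i, j) \<in> translate p T \<longleftrightarrow> p \<le> i \<and> p \<le> j \<and> (i - p, j - p) \<in> T"
  unfolding translate_def by force

text \<open>This lets one test, written for a window at the origin, serve every row. The factors are
  restricted to indices from \<open>p\<close> on in one direction and extended by 0 in the
  other.\<close>

lemma good_translate:
  "good e (translate p T) \<longleftrightarrow> good (\<lambda>a b. e (p + a) (p + b)) T"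
proof
  assume "good e (translate p T)"
  then obtain b c where bc: "\<And>i j. b i * c j + e i j = e i j"
    "\<And>i j. (i, j) \<in> translate p T \<Longrightarrow> b i * c j = e i j"
    "\<And>i j. (i, j) \<in> translate p T \<Longrightarrow> e i j \<noteq> 0"
    by (rule goodE) (rule that)
  show "good (\<lambda>a b. e (p + a) (p + b)) T"
    by (rule goodI[of "\<lambda>i. b (p + i)" "\<lambda>j. c (p + j)"]) (auto simp: bc mem_translate)
next
  assume "good (\<lambda>a b. e (p + a) (p + b)) T"
  then obtain b c where bc: "\<And>i j. b i * c j + e (p + i) (p + j) = e (p + i) (p + j)"
    "\<And>i j. (i, j) \<in> T \<Longrightarrow> b i * c j = e (p + i) (p + j)"
    "\<And>i j. (i, j) \<in> T \<Longrightarrow> e (p + i) (p + j) \<noteq> 0"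
    by (rule goodE) (rule that)
  show "good e (translate p T)"
  proof (rule goodI[of "\<lambda>i. if p \<le> i then b (i - p) else 0" "\<lambda>j. if p \<le> j then c (j - p) else 0"])
    show "(if p \<le> i then b (i - p) else 0) * (if p \<le> j then c (j - p) else 0) + e i j = e i j" for i j
      using bc(1)[of "i - p" "j - p"] by auto
    show "(if p \<le> i then b (i - p) else 0) * (if p \<le> j then c (j - p) else 0) = e i j"
      "e i j \<noteq> 0" if "(i, j) \<in> translate p T" for i j
      using bc(2,3)[of "i - p" "j - p"] that by (auto simp: mem_translate)
  qed
qed

text \<open>Columns are shifted by \<open>K\<close>, so that the band becomes \<open>i \<le> c \<le> i + 2 * K\<close> and no subtraction
  is truncated.\<close>

definition padded_entry :: "nat \<Rightarrow> 'a :: zero mat \<Rightarrow> nat \<Rightarrow> nat \<Rightarrow> 'a" where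
  "padded_entry K A i c =
     (if i < dim_row A \<and> K \<le> c \<and> c < dim_col A + K then A $$ (i, c - K) else 0)"

lemma padded_entry_shift: "i < dim_row A \<Longrightarrow> j < dim_col A \<Longrightarrow> padded_entry K A i (j + K) = A $$ (i, j)"
  by (simp add: padded_entry_def)

definition support :: "(nat \<Rightarrow> nat \<Rightarrow> 'a :: zero) \<Rightarrow> (nat \<times> nat) set" where
  "support e = {(i, c). e i c \<noteq> 0}"

section \<open>Factorizations as covers by good sets\<close>

definition good_cover :: "(nat \<Rightarrow> nat \<Rightarrow> 'a :: selective_semiring) \<Rightarrow> (nat \<times> nat) set set \<Rightarrow> bool" where
  "good_cover e \<F> \<longleftrightarrow> finite \<F> \<and> (\<forall>T\<in>\<F>. good e T) \<and> support e \<subseteq> \<Union>\<F>"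

text \<open>The \<open>l\<close>-th set consists of the nonzero entries attained by column
  \<open>l\<close> of \<open>B\<close> times row \<open>l\<close> of \<open>C\<close>. Selectivity
  means that every nonzero entry is attained by some summand.\<close>

lemma factorization_imp_cover:
  fixes B C :: "'a :: selective_semiring mat"
  assumes B: "B \<in> carrier_mat m r" and C: "C \<in> carrier_mat r n"
  shows "\<exists>\<F>. good_cover (padded_entry K (B * C)) \<F> \<and> card \<F> \<le> r"
proof -
  let ?e = "padded_entry K (B * C)"
  define b where "b l i = (if i < m then B $$ (i, l) else 0)" for l i
  define c where "c l j = (if K \<le> j \<and> j < n + K then C $$ (l, j - K) else 0)" for l j
  define T where "T l = {(i, j). ?e i j \<noteq> 0 \<and> b l i * c l j = ?e i j}" for l
  \<comment> \<open>This also holds outside the matrix, where both sides are 0 because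
    \<open>b\<close> and \<open>c\<close> are extended by 0.\<close>
  have e: "?e i j = (\<Sum>l<r. b l i * c l j)" for i j
  proof (cases "i < m \<and> K \<le> j \<and> j < n + K")
    case True
    then have "j - K < n" by auto
    with True B C show ?thesis
      by (auto simp: padded_entry_def b_def c_def scalar_prod_def lessThan_atLeast0 intro!: sum.cong)
  next
    case False
    then show ?thesis using B C by (auto simp: padded_entry_def b_def c_def)
  qed
  have "good ?e (T l)" if "l < r" for l
  proof (rule goodI[of "b l" "c l"])
    show "b l i * c l j + ?e i j = ?e i j" for i j
      using sum_absorb[of "{..<r}" l "\<lambda>l. b l i * c l j"] that by (simp add: e)
  qed (auto simp: T_def)
  moreover have "support ?e \<subseteq> (\<Union>l<r. T l)"
  proof clarify
    fix i j assume "(i, j) \<in> support ?e"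
    then have ne: "?e i j \<noteq> 0" by (simp add: support_def)
    then have "\<exists>l\<in>{..<r}. b l i * c l j = ?e i j"
      using sum_selective[of "{..<r}" "\<lambda>l. b l i * c l j"] by (simp add: e)
    with ne show "(i, j) \<in> (\<Union>l<r. T l)" by (auto simp: T_def)
  qed
  ultimately have "good_cover ?e (T ` {..<r})" by (auto simp: good_cover_def)
  moreover have "card (T ` {..<r}) \<le> r" using card_image_le[of "{..<r}" T] by simp
  ultimately show ?thesis by blast
qed

lemma cover_imp_factorization:
  fixes A :: "'a :: selective_semiring mat"
  assumes cov: "good_cover (padded_entry K A) \<F>" and r: "card \<F> \<le> r"
  shows "\<exists>B C. B \<in> carrier_mat (dim_row A) r \<and> C \<in> carrier_mat r (dim_col A) \<and> B * C = A"
proof -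
  let ?e = "padded_entry K A"
  have fin: "finite \<F>" using cov by (simp add: good_cover_def)
  obtain f where f: "bij_betw f {..<card \<F>} \<F>"
    using ex_bij_betw_nat_finite[OF fin] by (auto simp: lessThan_atLeast0)
  \<comment> \<open>A cover with fewer than \<open>r\<close> sets is filled up with the empty set,
    which is good.\<close>
  define T where "T l = (if l < card \<F> then f l else {})" for l
  have "\<exists>b c. (\<forall>i j. b i * c j + ?e i j = ?e i j) \<and> (\<forall>i j. (i, j) \<in> T l \<longrightarrow> b i * c j = ?e i j)" for l
  proof -
    have "good ?e (T l)"
      using cov bij_betwE[OF f] by (auto simp: T_def good_empty good_cover_def)
    then obtain b c where "\<And>i j. b i * c j + ?e i j = ?e i j"
      "\<And>i j. (i, j) \<in> T l \<Longrightarrow> b i * c j = ?e i j" "\<And>i j. (i, j) \<in> T l \<Longrightarrow> ?e i j \<noteq> 0"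
      by (rule goodE) (rule that)
    then show ?thesis by (intro exI[of _ b] exI[of _ c]) simp
  qed
  then obtain b c where bc: "\<And>l i j. b l i * c l j + ?e i j = ?e i j"
    "\<And>l i j. (i, j) \<in> T l \<Longrightarrow> b l i * c l j = ?e i j"
    by metis
  define B where "B = mat (dim_row A) r (\<lambda>(i, l). b l i)"
  define C where "C = mat r (dim_col A) (\<lambda>(l, j). c l (j + K))"
  have "B * C = A"
  proof (rule eq_matI)
    fix i j assume ij: "i < dim_row A" "j < dim_col A"
    have e: "?e i (j + K) = A $$ (i, j)" using ij by (rule padded_entry_shift)
    have "(B * C) $$ (i, j) = (\<Sum>l<r. b l i * c l (j + K))"
      using ij by (simp add: B_def C_def scalar_prod_def lessThan_atLeast0)
    also have "\<dots> = A $$ (i, j)"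
    proof (rule sum_eqI_selective)
      show "b l i * c l (j + K) + A $$ (i, j) = A $$ (i, j)" for l
        using bc(1)[of l i "j + K"] by (simp add: e)
      assume "A $$ (i, j) \<noteq> 0"
      then have "(i, j + K) \<in> support ?e" by (simp add: support_def e)
      then obtain t where "t \<in> \<F>" "(i, j + K) \<in> t" using cov by (auto simp: good_cover_def)
      then obtain l where "l < card \<F>" "(i, j + K) \<in> T l"
        using f by (auto simp: T_def bij_betw_def)
      then show "\<exists>l\<in>{..<r}. b l i * c l (j + K) = A $$ (i, j)"
        using r bc(2)[of i "j + K" l] by (auto simp: e)
    qed simp
    finally show "(B * C) $$ (i, j) = A $$ (i, j)" .
  qed (simp_all add: B_def C_def)
  then show ?thesis by (intro exI[of _ B] exI[of _ C]) (simp add: B_def C_def)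
qed

lemma factorization_rank_eq_cover:
  "factorization_rank (A :: 'a :: selective_semiring mat) =
     (LEAST r. \<exists>\<F>. good_cover (padded_entry K A) \<F> \<and> card \<F> \<le> r)"
proof -
  have "(\<exists>B C. B \<in> carrier_mat (dim_row A) r \<and> C \<in> carrier_mat r (dim_col A) \<and> B * C = A) \<longleftrightarrow>
    (\<exists>\<F>. good_cover (padded_entry K A) \<F> \<and> card \<F> \<le> r)" for r
    using factorization_imp_cover cover_imp_factorization by metis
  then show ?thesis by (simp add: factorization_rank_def)
qed


section \<open>Good sets over the fuzzy algebra\<close>

instance fuzzy :: selective_semiring
  by standard (transfer; auto simp: min_def max_def)+

lemma fuzzy_val_bounds: "0 \<le> fuzzy_val x" "fuzzy_val x \<le> 1"
  using fuzzy_val[of x] by auto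

lemma fuzzy_val_pos: "0 < fuzzy_val x \<longleftrightarrow> x \<noteq> 0"
  using fuzzy_val_bounds[of x] by (auto simp: fuzzy_val_inject[symmetric] zero_fuzzy.rep_eq)

lemma fuzzy_absorb: "x + y = (y :: fuzzy) \<longleftrightarrow> fuzzy_val x \<le> fuzzy_val y"
  by (simp add: fuzzy_val_inject[symmetric] plus_fuzzy.rep_eq max_def)

text \<open>If \<open>min (b i) (c j)\<close> attains the entries at \<open>x\<close> and
  \<open>y\<close>, then the row factor of \<open>x\<close> and the column factor of
  \<open>y\<close> are at least these entries, so their minimum forces the mixed entry up.
  Conversely, let the row factor be the largest entry of \<open>T\<close> in that row, and likewise
  for columns. The condition is written with strict comparisons because these are the ones the
  machine offers.\<close>

lemma good_fuzzy_iff: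
  fixes e :: "nat \<Rightarrow> nat \<Rightarrow> fuzzy"
  defines "r \<equiv> \<lambda>i j. fuzzy_val (e i j)"
  assumes "finite T"
  shows "good e T \<longleftrightarrow> (\<forall>x\<in>T. 0 < r (fst x) (snd x)) \<and>
    (\<forall>x\<in>T. \<forall>y\<in>T. \<not> (r (fst x) (snd y) < r (fst x) (snd x) \<and> r (fst x) (snd y) < r (fst y) (snd y)))"
    (is "_ \<longleftrightarrow> ?R")
proof
  assume "good e T"
  then obtain b c where bc: "\<And>i j. b i * c j + e i j = e i j"
    "\<And>i j. (i, j) \<in> T \<Longrightarrow> b i * c j = e i j" "\<And>i j. (i, j) \<in> T \<Longrightarrow> e i j \<noteq> 0"
    by (rule goodE) (rule that)
  have le: "min (fuzzy_val (b i)) (fuzzy_val (c j)) \<le> r i j" for i j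
    using bc(1)[of i j] by (simp add: fuzzy_absorb times_fuzzy.rep_eq r_def)
  have eq: "min (fuzzy_val (b i)) (fuzzy_val (c j)) = r i j" if "(i, j) \<in> T" for i j
    using bc(2)[OF that] by (simp add: times_fuzzy.rep_eq r_def flip: bc(2)[OF that])
  show ?R
  proof (intro conjI ballI)
    show "0 < r (fst x) (snd x)" if "x \<in> T" for x
      using bc(3) that by (simp add: r_def fuzzy_val_pos)
    show "\<not> (r (fst x) (snd y) < r (fst x) (snd x) \<and> r (fst x) (snd y) < r (fst y) (snd y))"
      if "x \<in> T" "y \<in> T" for x y
      using eq[of "fst x" "snd x"] eq[of "fst y" "snd y"] le[of "fst x" "snd y"] that by auto
  qed
next
  assume R: ?R
  define \<beta> where "\<beta> i = Max (insert 0 ((\<lambda>x. r (fst x) (snd x)) ` {x \<in> T. fst x = i}))" for i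
  define \<gamma> where "\<gamma> j = Max (insert 0 ((\<lambda>x. r (fst x) (snd x)) ` {x \<in> T. snd x = j}))" for j
  have r: "0 \<le> r i j" "r i j \<le> 1" for i j by (simp_all add: r_def fuzzy_val_bounds)
  have \<beta>: "\<beta> i = 0 \<or> (\<exists>x\<in>T. fst x = i \<and> \<beta> i = r (fst x) (snd x))" for i
    using Max_in[of "insert 0 ((\<lambda>x. r (fst x) (snd x)) ` {x \<in> T. fst x = i})"] \<open>finite T\<close>
    unfolding \<beta>_def[symmetric] by auto
  have \<gamma>: "\<gamma> j = 0 \<or> (\<exists>x\<in>T. snd x = j \<and> \<gamma> j = r (fst x) (snd x))" for j
    using Max_in[of "insert 0 ((\<lambda>x. r (fst x) (snd x)) ` {x \<in> T. snd x = j})"] \<open>finite T\<close>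
    unfolding \<gamma>_def[symmetric] by auto
  have ge: "r (fst x) (snd x) \<le> \<beta> (fst x)" "r (fst x) (snd x) \<le> \<gamma> (snd x)" if "x \<in> T" for x
    using that \<open>finite T\<close> unfolding \<beta>_def \<gamma>_def by (auto intro!: Max_ge)
  have in01: "\<beta> i \<in> {0..1}" "\<gamma> i \<in> {0..1}" for i
    using \<beta>[of i] \<gamma>[of i] r by auto
  have le: "min (\<beta> i) (\<gamma> j) \<le> r i j" for i j
  proof (cases "\<beta> i = 0 \<or> \<gamma> j = 0")
    case True
    then show ?thesis using r(1)[of i j] by auto
  next
    case False
    then obtain x y where "x \<in> T" "fst x = i" "\<beta> i = r (fst x) (snd x)"
      "y \<in> T" "snd y = j" "\<gamma> j = r (fst y) (snd y)" using \<beta>[of i] \<gamma>[of j] by auto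
    then show ?thesis using R by (fastforce simp: min_def not_less)
  qed
  have val: "fuzzy_val (Fuzzy (\<beta> i) * Fuzzy (\<gamma> j)) = min (\<beta> i) (\<gamma> j)" for i j
    by (simp add: times_fuzzy.rep_eq Fuzzy_inverse[OF in01(1)] Fuzzy_inverse[OF in01(2)])
  show "good e T"
  proof (rule goodI[of "\<lambda>i. Fuzzy (\<beta> i)" "\<lambda>j. Fuzzy (\<gamma> j)"])
    show "Fuzzy (\<beta> i) * Fuzzy (\<gamma> j) + e i j = e i j" for i j
      using le[of i j] by (simp add: fuzzy_absorb val r_def)
    show "Fuzzy (\<beta> i) * Fuzzy (\<gamma> j) = e i j" if "(i, j) \<in> T" for i j
      using le[of i j] ge[OF that] by (simp add: fuzzy_val_inject[symmetric] val r_def)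
    show "e i j \<noteq> 0" if "(i, j) \<in> T" for i j
      using R that by (auto simp: r_def fuzzy_val_pos)
  qed
qed


section \<open>Good sets over the tropical semiring\<close>

instance tropical :: selective_semiring
  by standard (transfer; auto simp: max_def)+

lemma tropical_val_nonneg: "0 \<le> tropical_val x"
  using tropical_val[of x] by auto

lemma tropical_val_pos: "0 < tropical_val x \<longleftrightarrow> x \<noteq> 0"
  using tropical_val_nonneg[of x] by (auto simp: tropical_val_inject[symmetric] zero_tropical.rep_eq)

lemma tropical_absorb: "x + y = (y :: tropical) \<longleftrightarrow> tropical_val x \<le> tropical_val y"
  by (simp add: tropical_val_inject[symmetric] plus_tropical.rep_eq max_def)

section \<open>Closed walks and potentials\<close>

fun walk :: "('b \<Rightarrow> 'b \<Rightarrow> 'a :: comm_monoid_mult) \<Rightarrow> 'b list \<Rightarrow> 'a" where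
  "walk w (x # y # zs) = w x y * walk w (y # zs)"
| "walk w _ = 1"

lemma walk_append: "walk w (xs @ x # ys) = walk w (xs @ [x]) * walk w (x # ys)"
proof (induction xs)
  case (Cons a xs)
  then show ?case by (cases xs) (simp_all add: mult.assoc)
qed simp

lemma walk_pos:
  assumes "\<And>x y. x \<in> set xs \<Longrightarrow> y \<in> set xs \<Longrightarrow> 0 < w x y"
  shows "0 < (walk w xs :: real)"
  using assms by (induction w xs rule: walk.induct) auto

text \<open>Each denominator is charged to the vertex that a step enters. On a closed walk through
  distinct vertices every vertex is entered exactly once, so "weight at least 1" becomes an
  inequality between two products.\<close>

lemma walk_divide:
  assumes "\<And>y. y \<in> set xs \<Longrightarrow> g y \<noteq> 0"
  shows "walk (\<lambda>x y. f x y / g y) (x # xs) = walk f (x # xs) / (prod_list (map g xs) :: real)"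
  using assms by (induction xs arbitrary: x) auto

lemma finite_distinct_lists: "finite T \<Longrightarrow> finite {xs. distinct xs \<and> set xs \<subseteq> T}"
  by (rule finite_subset[OF _ finite_lists_length_le[of T "card T"]])
    (auto simp: distinct_card[symmetric] intro: card_mono)

text \<open>\<open>u x\<close> is the least weight of a simple path starting in \<open>x\<close>.\<close>

lemma potential_exists:
  fixes w :: "'b \<Rightarrow> 'b \<Rightarrow> real"
  assumes fin: "finite T" and pos: "\<And>x y. x \<in> T \<Longrightarrow> y \<in> T \<Longrightarrow> 0 < w x y"
    and cyc: "\<And>x xs. distinct (x # xs) \<Longrightarrow> set (x # xs) \<subseteq> T \<Longrightarrow> 1 \<le> walk w (x # xs @ [x])"
  shows "\<exists>u. (\<forall>x\<in>T. 0 < u x) \<and> (\<forall>x\<in>T. \<forall>y\<in>T. u x \<le> w x y * u y)"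
proof -
  define S where "S x = (\<lambda>xs. walk w (x # xs)) ` {xs. distinct (x # xs) \<and> set (x # xs) \<subseteq> T}" for x
  define u where "u x = Min (S x)" for x
  have finS: "finite (S x)" for x
    unfolding S_def
    by (rule finite_imageI, rule finite_subset[OF _ finite_distinct_lists[OF fin]]) auto
  have u_in: "u x \<in> S x" if "x \<in> T" for x
    unfolding u_def using that by (intro Min_in finS) (auto simp: S_def intro: exI[of _ "[]"])
  have u_le: "u x \<le> walk w (x # xs)" if "distinct (x # xs)" "set (x # xs) \<subseteq> T" for x xs
    unfolding u_def using that by (intro Min_le finS) (auto simp: S_def)
  have "0 < u x" if x: "x \<in> T" for x
  proof -
    obtain xs where xs: "set (x # xs) \<subseteq> T" "u x = walk w (x # xs)"
      using u_in[OF x] by (auto simp: S_def)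
    then show ?thesis using pos by (simp only:) (rule walk_pos, blast)
  qed
  moreover have "u x \<le> w x y * u y" if x: "x \<in> T" and y: "y \<in> T" for x y
  proof -
    obtain ys where ys: "distinct (y # ys)" "set (y # ys) \<subseteq> T" "u y = walk w (y # ys)"
      using u_in[OF y] by (auto simp: S_def)
    show ?thesis
    proof (cases "x \<in> set (y # ys)")
      case False
      then show ?thesis using u_le[of x "y # ys"] ys x by simp
    next
      case True
      \<comment> \<open>Prepending \<open>x\<close> would close a cycle. Cutting it off leaves the
        simple path \<open>x # bs\<close>, and this does not increase the weight because the cycle
        weighs at least 1.\<close>
      then obtain as bs where ab: "y # ys = as @ x # bs" by (meson split_list)
      have "distinct (x # as)" "set (x # as) \<subseteq> T"
        using ys(1,2) unfolding ab by auto
      then have "1 \<le> walk w (x # as @ [x])" by (rule cyc)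
      moreover have "w x y * walk w (as @ [x]) = walk w (x # as @ [x])"
        using ab by (cases as) auto
      moreover have bs: "distinct (x # bs)" "set (x # bs) \<subseteq> T" using ys(1,2) unfolding ab by auto
      moreover have "0 < walk w (x # bs)" using bs(2) pos by (intro walk_pos) auto
      moreover have "u y = walk w (as @ [x]) * walk w (x # bs)" unfolding ys(3) ab by (rule walk_append)
      moreover note u_le[OF bs]
      ultimately show ?thesis
        by (smt (verit) mult.assoc mult_le_cancel_right1)
    qed
  qed
  ultimately show ?thesis by blast
qed

text \<open>Regrouping: the row factor of each vertex is paired with the column factor of its
  successor, and each pair is dominated by the weight of that step. With \<open>z = x\<close> this
  is the cycle condition for a rank-one matrix.\<close>

lemma walk_rank_one_le:
  fixes \<beta> \<gamma> :: "nat \<Rightarrow> real"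
  assumes "\<And>i j. \<beta> i * \<gamma> j \<le> r i j" "\<And>i. 0 \<le> \<beta> i" "\<And>j. 0 \<le> \<gamma> j"
  shows "\<beta> (fst x) * prod_list (map (\<lambda>y. \<beta> (fst y) * \<gamma> (snd y)) xs) * \<gamma> (snd z) \<le>
    walk (\<lambda>x y. r (fst x) (snd y)) (x # xs @ [z])"
proof (induction xs arbitrary: x)
  case Nil
  then show ?case using assms(1) by simp
next
  case (Cons y xs)
  have "0 \<le> prod_list (map (\<lambda>y. \<beta> (fst y) * \<gamma> (snd y)) xs)"
    using assms(2,3) by (intro prod_list_nonneg) auto
  then have "(\<beta> (fst x) * \<gamma> (snd y)) * (\<beta> (fst y) * prod_list (map (\<lambda>y. \<beta> (fst y) * \<gamma> (snd y)) xs) * \<gamma> (snd z))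
    \<le> r (fst x) (snd y) * walk (\<lambda>x y. r (fst x) (snd y)) (y # xs @ [z])"
    using assms Cons.IH[of y] order_trans[OF _ assms(1)] by (intro mult_mono) auto
  then show ?case by (simp add: mult_ac)
qed

text \<open>Conversely, the cycle condition yields a potential \<open>u\<close> for the ratios
  \<open>w x y\<close>. The factors are \<open>u x\<close> for the row of \<open>x\<close> and
  \<open>g y / u y\<close> for the column of \<open>y\<close>; that their product stays below the
  entry is exactly \<open>u x \<le> w x y * u y\<close>. They are well defined since
  \<open>w\<close> is 1 both ways within a row, and \<open>g x / g y\<close> and its inverse within
  a column.\<close>

lemma good_tropical_iff:
  fixes e :: "nat \<Rightarrow> nat \<Rightarrow> tropical"
  defines "r \<equiv> \<lambda>i j. tropical_val (e i j)"
  assumes fin: "finite T"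
  shows "good e T \<longleftrightarrow> (\<forall>x\<in>T. 0 < r (fst x) (snd x)) \<and>
    (\<forall>x xs. distinct (x # xs) \<longrightarrow> set (x # xs) \<subseteq> T \<longrightarrow>
      prod_list (map (\<lambda>x. r (fst x) (snd x)) (x # xs)) \<le> walk (\<lambda>x y. r (fst x) (snd y)) (x # xs @ [x]))"
    (is "_ \<longleftrightarrow> ?R")
proof
  assume "good e T"
  then obtain b c where bc: "\<And>i j. b i * c j + e i j = e i j"
    "\<And>i j. (i, j) \<in> T \<Longrightarrow> b i * c j = e i j" "\<And>i j. (i, j) \<in> T \<Longrightarrow> e i j \<noteq> 0"
    by (rule goodE) (rule that)
  define \<beta> where "\<beta> i = tropical_val (b i)" for i
  define \<gamma> where "\<gamma> j = tropical_val (c j)" for j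
  have le: "\<beta> i * \<gamma> j \<le> r i j" for i j
    using bc(1)[of i j] by (simp add: tropical_absorb times_tropical.rep_eq r_def \<beta>_def \<gamma>_def)
  have eq: "r (fst x) (snd x) = \<beta> (fst x) * \<gamma> (snd x)" if "x \<in> T" for x
    using bc(2)[of "fst x" "snd x"] that
    by (simp add: r_def \<beta>_def \<gamma>_def flip: times_tropical.rep_eq)
  show ?R
  proof (intro conjI ballI allI impI)
    show "0 < r (fst x) (snd x)" if "x \<in> T" for x
      using bc(3) that by (simp add: r_def tropical_val_pos)
    fix x xs assume T: "set (x # xs) \<subseteq> T"
    have "prod_list (map (\<lambda>x. r (fst x) (snd x)) (x # xs)) =
      prod_list (map (\<lambda>y. \<beta> (fst y) * \<gamma> (snd y)) (x # xs))"
      using T eq by (intro arg_cong[of _ _ prod_list] map_cong) auto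
    also have "\<dots> = \<beta> (fst x) * prod_list (map (\<lambda>y. \<beta> (fst y) * \<gamma> (snd y)) xs) * \<gamma> (snd x)"
      by (simp add: mult_ac)
    also have "\<dots> \<le> walk (\<lambda>x y. r (fst x) (snd y)) (x # xs @ [x])"
      using le by (intro walk_rank_one_le) (auto simp: \<beta>_def \<gamma>_def tropical_val_nonneg)
    finally show "prod_list (map (\<lambda>x. r (fst x) (snd x)) (x # xs)) \<le>
      walk (\<lambda>x y. r (fst x) (snd y)) (x # xs @ [x])" .
  qed
next
  assume R: ?R
  define g where "g x = r (fst x) (snd x)" for x
  define f where "f x y = r (fst x) (snd y)" for x y :: "nat \<times> nat"
  define w where "w x y = f x y / g y" for x y
  have gpos: "0 < g x" if "x \<in> T" for x using R that by (simp add: g_def)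
  have cyc: "prod_list (map g (x # xs)) \<le> walk f (x # xs @ [x])"
    if "distinct (x # xs)" "set (x # xs) \<subseteq> T" for x xs
    using R that unfolding g_def f_def by blast
  have r0: "0 \<le> r i j" for i j by (simp add: r_def tropical_val_nonneg)
  have prod_pos: "0 < prod_list (map g xs)" if "set xs \<subseteq> T" for xs
    using that by (induction xs) (auto simp: gpos)
  \<comment> \<open>The cycle through \<open>x\<close> and \<open>y\<close> already rules out a
    vanishing mixed entry, so all ratios are positive.\<close>
  have fpos: "0 < f x y" if xy: "x \<in> T" "y \<in> T" for x y
  proof (cases "x = y")
    case True
    then show ?thesis using gpos[OF xy(1)] by (simp add: f_def g_def)
  next
    case False
    then have "g x * g y \<le> f x y * f y x" using cyc[of x "[y]"] xy by simp
    then have "f x y \<noteq> 0" using mult_pos_pos[OF gpos[OF xy(1)] gpos[OF xy(2)]] by auto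
    then show ?thesis using r0[of "fst x" "snd y"] by (simp add: f_def)
  qed
  have "\<exists>u. (\<forall>x\<in>T. 0 < u x) \<and> (\<forall>x\<in>T. \<forall>y\<in>T. u x \<le> w x y * u y)"
  proof (rule potential_exists[OF fin])
    show "0 < w x y" if "x \<in> T" "y \<in> T" for x y
      using that by (simp add: w_def fpos gpos)
    fix x xs assume xs: "distinct (x # xs)" "set (x # xs) \<subseteq> T"
    have "walk w (x # xs @ [x]) = walk f (x # xs @ [x]) / prod_list (map g (xs @ [x]))"
      unfolding w_def using xs gpos by (intro walk_divide) (force simp: less_le)
    moreover have "prod_list (map g (xs @ [x])) = prod_list (map g (x # xs))" by (simp add: mult.commute)
    moreover have "0 < prod_list (map g (x # xs))"
      using prod_pos[OF xs(2)] .
    ultimately show "1 \<le> walk w (x # xs @ [x])" using cyc[OF xs] by (simp only: le_divide_eq_1_pos)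
  qed
  then obtain u where u: "\<And>x. x \<in> T \<Longrightarrow> 0 < u x" "\<And>x y. x \<in> T \<Longrightarrow> y \<in> T \<Longrightarrow> u x \<le> w x y * u y"
    by blast
  have u_row: "u x = u y" if "x \<in> T" "y \<in> T" "fst x = fst y" for x y
  proof -
    have "w x y = 1" "w y x = 1" using that gpos[OF that(1)] gpos[OF that(2)] by (auto simp: w_def f_def g_def)
    then show ?thesis using u(2)[of x y] u(2)[of y x] that by simp
  qed
  have u_col: "g x / u x = g y / u y" if "x \<in> T" "y \<in> T" "snd x = snd y" for x y
  proof -
    have "w x y = g x / g y" "w y x = g y / g x" using that by (auto simp: w_def f_def g_def)
    then have "u x \<le> g x * u y / g y" "u y \<le> g y * u x / g x"
      using u(2)[of x y] u(2)[of y x] that by simp_all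
    then have "u x * g y = u y * g x"
      using gpos[OF that(1)] gpos[OF that(2)] by (simp add: pos_le_divide_eq mult.commute)
    then show ?thesis using u(1)[OF that(1)] u(1)[OF that(2)] by (simp add: field_simps)
  qed
  define \<beta> where "\<beta> i = (if \<exists>x\<in>T. fst x = i then u (SOME x. x \<in> T \<and> fst x = i) else 0)" for i
  define \<gamma> where "\<gamma> j = (if \<exists>x\<in>T. snd x = j then
    (let x = (SOME x. x \<in> T \<and> snd x = j) in g x / u x) else 0)" for j
  have \<beta>: "\<beta> (fst x) = u x" if "x \<in> T" for x
  proof -
    have "(SOME y. y \<in> T \<and> fst y = fst x) \<in> T \<and> fst (SOME y. y \<in> T \<and> fst y = fst x) = fst x"
      using someI[of "\<lambda>y. y \<in> T \<and> fst y = fst x" x] that by simp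
    then show ?thesis using u_row[of "SOME y. y \<in> T \<and> fst y = fst x" x] that by (auto simp: \<beta>_def)
  qed
  have \<gamma>: "\<gamma> (snd x) = g x / u x" if "x \<in> T" for x
  proof -
    have "(SOME y. y \<in> T \<and> snd y = snd x) \<in> T \<and> snd (SOME y. y \<in> T \<and> snd y = snd x) = snd x"
      using someI[of "\<lambda>y. y \<in> T \<and> snd y = snd x" x] that by simp
    then show ?thesis
      using u_col[of "SOME y. y \<in> T \<and> snd y = snd x" x] that by (auto simp: \<gamma>_def Let_def)
  qed
  have \<beta>0: "(\<exists>x\<in>T. fst x = i) \<or> \<beta> i = 0" and \<gamma>0: "(\<exists>x\<in>T. snd x = i) \<or> \<gamma> i = 0" for i
    by (auto simp: \<beta>_def \<gamma>_def)
  have nonneg: "0 \<le> \<beta> i" "0 \<le> \<gamma> i" for i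
    using \<beta>0[of i] \<gamma>0[of i] \<beta> \<gamma> u(1) gpos by (auto simp: less_imp_le)
  have le: "\<beta> i * \<gamma> j \<le> r i j" for i j
  proof (cases "\<beta> i = 0 \<or> \<gamma> j = 0")
    case True
    then show ?thesis using r0[of i j] by auto
  next
    case False
    then obtain x y where xy: "x \<in> T" "fst x = i" "y \<in> T" "snd y = j"
      using \<beta>0[of i] \<gamma>0[of j] by blast
    then have "\<beta> i = u x" "\<gamma> j = g y / u y" using \<beta>[OF xy(1)] \<gamma>[OF xy(3)] by simp_all
    moreover have "u x * g y \<le> r i j * u y"
      using u(2)[OF xy(1,3)] gpos[OF xy(3)] xy by (simp add: w_def f_def field_simps)
    ultimately show ?thesis using u(1)[OF xy(3)] by (simp add: pos_divide_le_eq)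
  qed
  have val: "tropical_val (Tropical (\<beta> i) * Tropical (\<gamma> j)) = \<beta> i * \<gamma> j" for i j
    by (simp add: times_tropical.rep_eq Tropical_inverse nonneg)
  show "good e T"
  proof (rule goodI[of "\<lambda>i. Tropical (\<beta> i)" "\<lambda>j. Tropical (\<gamma> j)"])
    show "Tropical (\<beta> i) * Tropical (\<gamma> j) + e i j = e i j" for i j
      using le[of i j] by (simp add: tropical_absorb val r_def)
    show "Tropical (\<beta> i) * Tropical (\<gamma> j) = e i j" if "(i, j) \<in> T" for i j
    proof -
      have "\<beta> i * \<gamma> j = r i j" using \<beta>[OF that] \<gamma>[OF that] u(1)[OF that] by (simp add: g_def)
      then show ?thesis by (simp add: tropical_val_inject[symmetric] val r_def)
    qed
    show "e i j \<noteq> 0" if "(i, j) \<in> T" for i j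
      using R that by (auto simp: r_def tropical_val_pos)
  qed
qed


section \<open>Minimal covers of a band\<close>

definition window :: "nat \<Rightarrow> (nat \<times> nat) set" where
  "window K = {..2 * K} \<times> {..2 * K}"

lemma finite_window: "finite (window K)"
  by (simp add: window_def)

text \<open>Re-expresses the covered part relative to the next row. The first row and the first
  column of the window are dropped; rows below cannot meet that column, as padded columns of the
  band satisfy \<open>i \<le> c\<close>.\<close>

definition unshift :: "(nat \<times> nat) set \<Rightarrow> (nat \<times> nat) set" where
  "unshift U = {(a, b). (Suc a, Suc b) \<in> U}"

lemma unshift_window: "U \<subseteq> window K \<Longrightarrow> unshift U \<subseteq> window K"
  by (force simp: unshift_def window_def)

lemma translate_unshift: "translate (Suc p) (unshift U) \<subseteq> translate p U"
  by (auto simp: mem_translate unshift_def Suc_diff_le[symmetric] Suc_le_eq)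

text \<open>Order and repetitions are left open, since only minima and conjunctions are formed. The
  recursion and the program text use the same list, so their folds agree literally.\<close>

definition list_of :: "'b set \<Rightarrow> 'b list" where
  "list_of X = (SOME xs. set xs = X)"

lemma set_list_of: "finite X \<Longrightarrow> set (list_of X) = X"
  unfolding list_of_def by (metis (mono_tags, lifting) finite_list someI_ex)

lemma fold_min_le_init: "fold (\<lambda>x v. if b x then min v (f x) else v) xs v \<le> (v :: nat)"
proof (induction xs arbitrary: v)
  case (Cons y ys)
  then show ?case using Cons[of v] Cons[of "min v (f y)"] by auto
qed simp

lemma fold_min_le:
  "x \<in> set xs \<Longrightarrow> b x \<Longrightarrow> fold (\<lambda>x v. if b x then min v (f x) else v) xs v \<le> (f x :: nat)"
proof (induction xs arbitrary: v)
  case (Cons y ys)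
  then show ?case using fold_min_le_init[of b f ys "min v (f y)"] by auto
qed simp

lemma fold_min_cases:
  "fold (\<lambda>x v. if b x then min v (f x) else v) xs v = (v :: nat) \<or>
   (\<exists>x\<in>set xs. b x \<and> fold (\<lambda>x v. if b x then min v (f x) else v) xs v = f x)"
proof (induction xs arbitrary: v)
  case (Cons y ys)
  show ?case using Cons[of v] Cons[of "min v (f y)"] by (auto simp: min_def split: if_splits)
qed simp

text \<open>These properties are all that the covering problem takes from the semiring;
  \<open>P\<close> stands for the support in padded coordinates and \<open>G\<close> for
  goodness.\<close>

locale band_cover =
  fixes n K :: nat and P :: "(nat \<times> nat) set" and G :: "(nat \<times> nat) set \<Rightarrow> bool"
  assumes band: "(i, c) \<in> P \<Longrightarrow> i < n \<and> i \<le> c \<and> c \<le> i + 2 * K"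
    and G_subset: "G T \<Longrightarrow> T \<subseteq> P"
    and G_rectangle: "G T \<Longrightarrow> (i, j) \<in> T \<Longrightarrow> (i', j') \<in> T \<Longrightarrow> (i, j') \<in> P"
    and G_singleton: "x \<in> P \<Longrightarrow> G {x}"
begin

text \<open>A choice at row \<open>p\<close> has to complete this row only; whatever else it covers
  is passed on in the state. The range of \<open>b\<close> depends on \<open>S\<close> and
  \<open>F\<close> but not on \<open>P\<close>, so it can be expanded when the program is
  written.\<close>

definition valid :: "nat \<Rightarrow> (nat \<times> nat) set \<Rightarrow> (nat \<times> nat) set set \<Rightarrow> bool" where
  "valid p S F \<longleftrightarrow> (\<forall>T\<in>F. G (translate p T)) \<and>
     (\<forall>b\<in>{b. b \<le> 2 * K \<and> (0, b) \<notin> S \<union> \<Union>F}. (p, p + b) \<notin> P)"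

text \<open>\<open>opt d S\<close> is the least number of sets needed to cover the last \<open>d\<close> rows of \<open>P\<close> when, relative to
  position \<open>n - d\<close>, the part \<open>S\<close> is covered already. The first row can always be covered by
  \<open>2 * K + 1\<close> singletons; this makes an infinite value superfluous.\<close>

primrec opt :: "nat \<Rightarrow> (nat \<times> nat) set \<Rightarrow> nat" where
  "opt 0 S = 0"
| "opt (Suc d) S = fold (\<lambda>F v. if valid (n - Suc d) S F
       then min v (card F + opt d (unshift (S \<union> \<Union>F))) else v)
     (list_of (Pow (Pow (window K)))) (2 * K + 1 + opt d (unshift S))"

text \<open>The singleton default alone gives this bound. It keeps the numbers in the table, and
  hence the cost of handling them, small.\<close>

lemma opt_le: "opt d S \<le> (2 * K + 1) * d"
proof (induction d arbitrary: S)
  case (Suc d)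
  have "opt (Suc d) S \<le> 2 * K + 1 + opt d (unshift S)"
    unfolding opt.simps by (rule fold_min_le_init)
  then show ?case using Suc[of "unshift S"] by simp
qed simp

definition rows_from :: "nat \<Rightarrow> (nat \<times> nat) set" where
  "rows_from p = {x. p \<le> fst x}"

text \<open>Feasibility of the value: the default contributes the singletons of row
  \<open>p\<close>, any other choice the translates of its sets. By
  \<open>translate_unshift\<close>, what the next step presumes covered really is covered.\<close>

lemma opt_attained:
  assumes "d \<le> n"
  shows "\<exists>\<F>. finite \<F> \<and> (\<forall>T\<in>\<F>. G T) \<and> card \<F> \<le> opt d S \<and>
    P \<inter> rows_from (n - d) \<subseteq> translate (n - d) S \<union> \<Union>\<F>"
  using assms
proof (induction d arbitrary: S)
  case 0
  then show ?case using band by (intro exI[of _ "{}"]) (force simp: rows_from_def)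
next
  case (Suc d)
  define p where "p = n - Suc d"
  have p: "n - d = Suc p" using Suc.prems by (simp add: p_def)
  have split: "x \<in> P \<inter> rows_from p \<Longrightarrow> (\<exists>b\<le>2*K. x = (p, p + b)) \<or> x \<in> P \<inter> rows_from (Suc p)" for x
  proof (cases x)
    case (Pair i c)
    assume "x \<in> P \<inter> rows_from p"
    then show ?thesis using band[of i c] Pair
      by (cases "i = p") (auto simp: rows_from_def intro!: exI[of _ "c - p"])
  qed
  consider "opt (Suc d) S = 2 * K + 1 + opt d (unshift S)"
    | F where "F \<in> set (list_of (Pow (Pow (window K))))" "valid p S F"
      "opt (Suc d) S = card F + opt d (unshift (S \<union> \<Union>F))"
    unfolding opt.simps p_def
    using fold_min_cases[of "valid (n - Suc d) S" "\<lambda>F. card F + opt d (unshift (S \<union> \<Union>F))"] by blast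
  then show ?case
  proof cases
    case 1
    obtain \<F> where \<F>: "finite \<F>" "\<forall>T\<in>\<F>. G T" "card \<F> \<le> opt d (unshift S)"
      "P \<inter> rows_from (Suc p) \<subseteq> translate (Suc p) (unshift S) \<union> \<Union>\<F>"
      using Suc.IH[of "unshift S"] Suc.prems by (auto simp: p)
    define \<H> where "\<H> = (\<lambda>b. {(p, p + b)}) ` {b. b \<le> 2 * K \<and> (p, p + b) \<in> P}"
    have \<H>: "finite \<H>" by (simp add: \<H>_def)
    have "card \<H> \<le> card {b. b \<le> 2 * K \<and> (p, p + b) \<in> P}"
      unfolding \<H>_def by (rule card_image_le) simp
    also have "\<dots> \<le> card {..2 * K}" by (rule card_mono) auto
    finally have "card (\<F> \<union> \<H>) \<le> opt (Suc d) S"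
      using card_Un_le[of \<F> \<H>] \<F>(3) 1 by simp
    moreover have "P \<inter> rows_from p \<subseteq> translate p S \<union> \<Union>(\<F> \<union> \<H>)"
    proof
      fix x assume x: "x \<in> P \<inter> rows_from p"
      from split[OF x] show "x \<in> translate p S \<union> \<Union>(\<F> \<union> \<H>)"
      proof
        assume "\<exists>b\<le>2*K. x = (p, p + b)"
        then show ?thesis using x by (auto simp: \<H>_def)
      next
        assume "x \<in> P \<inter> rows_from (Suc p)"
        then show ?thesis using \<F>(4) translate_unshift[of p S] by blast
      qed
    qed
    moreover have "\<forall>T\<in>\<F> \<union> \<H>. G T" using \<F>(2) G_singleton by (auto simp: \<H>_def)
    moreover have "finite (\<F> \<union> \<H>)" using \<F>(1) \<H> by simp
    ultimately show ?thesis unfolding p_def[symmetric] by (intro exI[of _ "\<F> \<union> \<H>"] conjI)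
  next
    case (2 F)
    have F: "finite F" "F \<subseteq> Pow (window K)"
      using 2(1) finite_window[of K] by (auto simp: set_list_of intro: finite_subset)
    obtain \<F> where \<F>: "finite \<F>" "\<forall>T\<in>\<F>. G T" "card \<F> \<le> opt d (unshift (S \<union> \<Union>F))"
      "P \<inter> rows_from (Suc p) \<subseteq> translate (Suc p) (unshift (S \<union> \<Union>F)) \<union> \<Union>\<F>"
      using Suc.IH[of "unshift (S \<union> \<Union>F)"] Suc.prems by (auto simp: p)
    have un: "translate p (S \<union> \<Union>F) = translate p S \<union> \<Union>(translate p ` F)"
      by (auto simp: translate_def)
    have "card (\<F> \<union> translate p ` F) \<le> opt (Suc d) S"
      using card_Un_le[of \<F> "translate p ` F"] \<F>(3) 2(3) card_image_le[OF F(1), of "translate p"]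
      by simp
    moreover have "P \<inter> rows_from p \<subseteq> translate p S \<union> \<Union>(\<F> \<union> translate p ` F)"
    proof
      fix x assume x: "x \<in> P \<inter> rows_from p"
      from split[OF x] have "x \<in> translate p (S \<union> \<Union>F) \<union> \<Union>\<F>"
      proof
        assume "\<exists>b\<le>2*K. x = (p, p + b)"
        then obtain b where b: "b \<le> 2 * K" "x = (p, p + b)" by blast
        with x 2(2) have "(0, b) \<in> S \<union> \<Union>F" by (auto simp: valid_def)
        then show ?thesis by (auto simp: b(2) mem_translate)
      next
        assume "x \<in> P \<inter> rows_from (Suc p)"
        then show ?thesis using \<F>(4) translate_unshift[of p "S \<union> \<Union>F"] by blast
      qed
      then show "x \<in> translate p S \<union> \<Union>(\<F> \<union> translate p ` F)" by (auto simp: un)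
    qed
    moreover have "\<forall>T\<in>\<F> \<union> translate p ` F. G T" using \<F>(2) 2(2) by (auto simp: valid_def)
    moreover have "finite (\<F> \<union> translate p ` F)" using \<F>(1) F(1) by simp
    ultimately show ?thesis unfolding p_def[symmetric] by (intro exI[of _ "\<F> \<union> translate p ` F"] conjI)
  qed
qed

text \<open>Split a cover into the sets \<open>\<H>\<close> that meet row \<open>p\<close> and the
  rest. The former fit into the window at \<open>p\<close> and are among the choices of the
  recursion; the latter live in later rows and fall to the induction hypothesis, with the state
  enlarged by \<open>\<H>\<close>.\<close>

lemma opt_minimal:
  assumes "d \<le> n" "finite \<F>" "\<forall>T\<in>\<F>. G T \<and> T \<subseteq> rows_from (n - d)"
    "P \<inter> rows_from (n - d) \<subseteq> translate (n - d) S \<union> \<Union>\<F>"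
  shows "opt d S \<le> card \<F>"
  using assms
proof (induction d arbitrary: S \<F>)
  case (Suc d)
  define p where "p = n - Suc d"
  have p: "n - d = Suc p" using Suc.prems(1) by (simp add: p_def)
  note prems = Suc.prems[folded p_def]
  define \<H> where "\<H> = {T\<in>\<F>. \<exists>x\<in>T. fst x = p}"
  define rel where "rel T = {(a, b). (p + a, p + b) \<in> T}" for T :: "(nat \<times> nat) set"
  define F where "F = rel ` \<H>"
  have \<H>: "rel T \<subseteq> window K \<and> translate p (rel T) = T" if TH: "T \<in> \<H>" for T
  proof -
    obtain c0 where c0: "(p, c0) \<in> T" using TH by (auto simp: \<H>_def)
    have T: "G T" "T \<subseteq> rows_from p" using TH prems(3) by (auto simp: \<H>_def)
    \<comment> \<open>The rectangle property with \<open>(p, c0)\<close> puts \<open>(p, c)\<close>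
      and \<open>(i, c0)\<close> into the band, which bounds the column \<open>c\<close> and the row
      \<open>i\<close> respectively.\<close>
    have *: "p \<le> i \<and> i \<le> p + 2 * K \<and> p \<le> c \<and> c \<le> p + 2 * K" if ic: "(i, c) \<in> T" for i c
    proof -
      have "(p, c) \<in> P" "(i, c0) \<in> P" "(p, c0) \<in> P" using G_rectangle[OF T(1)] c0 ic by blast+
      then show ?thesis using band[of p c] band[of i c0] band[of p c0] T(2) ic
        by (auto simp: rows_from_def)
    qed
    have "rel T \<subseteq> window K" by (auto simp: rel_def window_def dest: *)
    moreover have "(i, c) \<in> translate p (rel T) \<longleftrightarrow> (i, c) \<in> T" for i c
      using *[of i c] by (auto simp: mem_translate rel_def)
    then have "translate p (rel T) = T" by auto
    ultimately show ?thesis ..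
  qed
  have F_win: "F \<in> set (list_of (Pow (Pow (window K))))"
    using \<H> finite_window[of K] by (auto simp: F_def set_list_of)
  have trF: "translate p (S \<union> \<Union>F) = translate p S \<union> \<Union>\<H>"
  proof -
    have "translate p (S \<union> \<Union>F) = translate p S \<union> \<Union>(translate p ` F)" by (auto simp: translate_def)
    also have "translate p ` F = \<H>" using \<H> by (force simp: F_def image_image)
    finally show ?thesis .
  qed
  have "valid p S F" unfolding valid_def
  proof (intro conjI ballI)
    fix T assume "T \<in> F"
    then obtain T' where "T' \<in> \<H>" "T = rel T'" by (auto simp: F_def)
    moreover from this(1) have "G T'" using prems(3) by (simp add: \<H>_def)
    ultimately show "G (translate p T)" using \<H> by simp
  next
    fix b assume b: "b \<in> {b. b \<le> 2 * K \<and> (0, b) \<notin> S \<union> \<Union>F}"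
    show "(p, p + b) \<notin> P"
    proof
      assume "(p, p + b) \<in> P"
      then have "(p, p + b) \<in> translate p S \<union> \<Union>\<F>" using prems(4) by (auto simp: rows_from_def)
      then have "(p, p + b) \<in> translate p (S \<union> \<Union>F)" unfolding trF by (force simp: \<H>_def)
      then show False using b by (simp add: mem_translate)
    qed
  qed
  then have "opt (Suc d) S \<le> card F + opt d (unshift (S \<union> \<Union>F))"
    unfolding opt.simps p_def[symmetric] using F_win
    by (intro fold_min_le[where f = "\<lambda>F. card F + opt d (unshift (S \<union> \<Union>F))"])
  also have "opt d (unshift (S \<union> \<Union>F)) \<le> card (\<F> - \<H>)"
  proof (rule Suc.IH)
    show "d \<le> n" "finite (\<F> - \<H>)" using prems(1,2) Suc.prems(1) by auto
    show "\<forall>T\<in>\<F> - \<H>. G T \<and> T \<subseteq> rows_from (n - d)"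
      using prems(3) unfolding p by (fastforce simp: \<H>_def rows_from_def)
    show "P \<inter> rows_from (n - d) \<subseteq> translate (n - d) (unshift (S \<union> \<Union>F)) \<union> \<Union>(\<F> - \<H>)"
      unfolding p
    proof
      fix x assume x: "x \<in> P \<inter> rows_from (Suc p)"
      obtain i c where ic: "x = (i, c)" by (cases x)
      have "x \<in> translate p (S \<union> \<Union>F) \<union> \<Union>(\<F> - \<H>)"
      proof -
        have "x \<in> P \<inter> rows_from p" using x by (auto simp: rows_from_def)
        then show ?thesis using prems(4) unfolding trF by blast
      qed
      \<comment> \<open>Row and column both exceed \<open>p\<close>, so nothing relevant is lost by
        \<open>unshift\<close>.\<close>
      moreover have "Suc p \<le> i" "Suc p \<le> c" using x band[of i c] by (auto simp: ic rows_from_def)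
      ultimately show "x \<in> translate (Suc p) (unshift (S \<union> \<Union>F)) \<union> \<Union>(\<F> - \<H>)"
        by (auto simp: ic mem_translate unshift_def Suc_diff_Suc)
    qed
  qed
  also have "card F + card (\<F> - \<H>) \<le> card \<F>"
  proof -
    have "card F \<le> card \<H>" unfolding F_def using prems(2) by (intro card_image_le) (simp add: \<H>_def)
    moreover have "card (\<F> - \<H>) = card \<F> - card \<H>" "card \<H> \<le> card \<F>"
      using prems(2) by (auto simp: \<H>_def intro!: card_Diff_subset card_mono)
    ultimately show ?thesis by simp
  qed
  finally show ?case by simp
qed simp

lemma opt_eq_Least:
  "opt n {} = (LEAST r. \<exists>\<F>. (finite \<F> \<and> (\<forall>T\<in>\<F>. G T) \<and> P \<subseteq> \<Union>\<F>) \<and> card \<F> \<le> r)"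
proof (rule Least_equality[symmetric])
  show "\<exists>\<F>. (finite \<F> \<and> (\<forall>T\<in>\<F>. G T) \<and> P \<subseteq> \<Union>\<F>) \<and> card \<F> \<le> opt n {}"
    using opt_attained[of n "{}"] by (auto simp: rows_from_def translate_def)
  show "opt n {} \<le> r" if "\<exists>\<F>. (finite \<F> \<and> (\<forall>T\<in>\<F>. G T) \<and> P \<subseteq> \<Union>\<F>) \<and> card \<F> \<le> r" for r
  proof -
    from that obtain \<F> where "finite \<F>" "\<forall>T\<in>\<F>. G T" "P \<subseteq> \<Union>\<F>" "card \<F> \<le> r" by blast
    then show ?thesis
      using opt_minimal[of n \<F> "{}"] by (auto simp: rows_from_def translate_def)
  qed
qed

end


section \<open>Running time of loop-free programs\<close>

lemma nat_size_less: "m < 2 ^ (nat_size m - 1)"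
  by (simp add: nat_size_def floorlog_leD)

lemma nat_size_le: "m < 2 ^ w \<Longrightarrow> nat_size m \<le> Suc w"
  by (simp add: nat_size_def floorlog_leI)

lemma nat_size_pos: "1 \<le> nat_size m"
  by (simp add: nat_size_def)

lemma nat_size_mono: "m \<le> m' \<Longrightarrow> nat_size m \<le> nat_size m'"
  by (simp add: nat_size_def floorlog_mono)

lemma nat_size_le_Suc: "nat_size m \<le> Suc m"
  by (rule nat_size_le) (rule less_exp)

lemma nat_size_mult: "nat_size (x * y) \<le> nat_size x + nat_size y"
proof -
  have "x * y < 2 ^ (nat_size x - 1 + (nat_size y - 1))"
    unfolding power_add by (intro mult_strict_mono nat_size_less) auto
  from nat_size_le[OF this] show ?thesis using nat_size_pos[of x] nat_size_pos[of y] by linarith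
qed

lemma nat_size_add: "nat_size (x + y) \<le> nat_size x + nat_size y"
proof -
  have "nat_size (x + y) \<le> nat_size (max x y * 2)" by (rule nat_size_mono) simp
  also have "\<dots> \<le> Suc (nat_size (max x y))"
    by (rule nat_size_le) (use nat_size_less[of "max x y"] nat_size_pos[of "max x y"] in
      \<open>auto simp: less_eq_Suc_le nat_size_def\<close>)
  also have "\<dots> \<le> nat_size x + nat_size y"
    using nat_size_pos[of x] nat_size_pos[of y] by (auto simp: max_def)
  finally show ?thesis .
qed

text \<open>Products are the only operations whose size \<open>size_measure\<close> controls, and
  the tests for good sets get by with them.\<close>

primrec mult_only :: "rexp \<Rightarrow> bool" where
  "mult_only RZero \<longleftrightarrow> True"
| "mult_only ROne \<longleftrightarrow> True"
| "mult_only (RLoad e) \<longleftrightarrow> True"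
| "mult_only (RAdd e f) \<longleftrightarrow> False"
| "mult_only (RSub e f) \<longleftrightarrow> False"
| "mult_only (RMul e f) \<longleftrightarrow> mult_only e \<and> mult_only f"
| "mult_only (RDiv e f) \<longleftrightarrow> False"

primrec mult_only_test :: "test \<Rightarrow> bool" where
  "mult_only_test (NLess e f) \<longleftrightarrow> True"
| "mult_only_test (RLess e f) \<longleftrightarrow> mult_only e \<and> mult_only f"
| "mult_only_test (TNot b) \<longleftrightarrow> mult_only_test b"
| "mult_only_test (TAnd b c) \<longleftrightarrow> mult_only_test b \<and> mult_only_test c"

text \<open>Excluding \<open>RStore\<close> leaves the input entries untouched, so the sizes of
  stored reals never change; excluding \<open>While\<close> makes the length of a run
  constant.\<close>

primrec simple :: "prog \<Rightarrow> bool" where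
  "simple Skip \<longleftrightarrow> True"
| "simple (NStore a e) \<longleftrightarrow> True"
| "simple (RStore a e) \<longleftrightarrow> False"
| "simple (Seq p q) \<longleftrightarrow> simple p \<and> simple q"
| "simple (Cond b p q) \<longleftrightarrow> mult_only_test b \<and> simple p \<and> simple q"
| "simple (While b p) \<longleftrightarrow> False"

primrec run :: "prog \<Rightarrow> state \<Rightarrow> state" where
  "run Skip s = s"
| "run (NStore a e) s = ((fst s)(nval a s := nval e s), snd s)"
| "run (RStore a e) s = (fst s, (snd s)(nval a s := rval e s))"
| "run (Seq p q) s = run q (run p s)"
| "run (Cond b p q) s = (if tval b s then run p s else run q s)"
| "run (While b p) s = s"

text \<open>Common ground of the two cost models. \<open>Q\<close> is the set of numbers that may
  occur, which confines the size bound for products to rationals in the bit model.\<close>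

locale size_measure =
  fixes sz :: "real \<Rightarrow> nat" and Q :: "real set"
  assumes zero_Q: "0 \<in> Q" and one_Q: "1 \<in> Q"
    and mult_Q: "x \<in> Q \<Longrightarrow> y \<in> Q \<Longrightarrow> x * y \<in> Q"
    and sz_mult: "x \<in> Q \<Longrightarrow> y \<in> Q \<Longrightarrow> sz (x * y) \<le> sz x + sz y"
    and sz_pos: "1 \<le> sz x"
begin

definition bounded_state :: "nat \<Rightarrow> state \<Rightarrow> bool" where
  "bounded_state L s \<longleftrightarrow> (\<forall>a. nat_size (fst s a) \<le> L) \<and> (\<forall>a. snd s a \<in> Q \<and> sz (snd s a) \<le> L)"

lemma bounded_state_pos: "bounded_state L s \<Longrightarrow> 1 \<le> L"
  unfolding bounded_state_def using nat_size_pos order_trans by blast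

lemma bounded_state_mono: "bounded_state L s \<Longrightarrow> L \<le> L' \<Longrightarrow> bounded_state L' s"
  unfolding bounded_state_def using order_trans by blast

text \<open>The constant depends on the expression alone: at each node sizes at most add up, even
  for products, because size is binary length.\<close>

lemma nexp_bound:
  "\<exists>C. \<forall>L s. bounded_state L s \<longrightarrow> nat_size (nval e s) \<le> C * L \<and> ncost e s \<le> C * L"
proof (induction e)
  case (NConst c)
  have "nat_size c \<le> nat_size c * L" if "bounded_state L s" for L s
    using bounded_state_pos[OF that] by simp
  then show ?case by (intro exI[of _ "nat_size c"]) auto
next
  case (NLoad e)
  then obtain C where C: "\<And>L s. bounded_state L s \<Longrightarrow> nat_size (nval e s) \<le> C * L \<and> ncost e s \<le> C * L"
    by blast
  have "nat_size (nval (NLoad e) s) \<le> (C + 1) * L \<and> ncost (NLoad e) s \<le> (C + 1) * L"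
    if b: "bounded_state L s" for L s
  proof -
    have "nat_size (fst s (nval e s)) \<le> L" using b by (simp add: bounded_state_def)
    then show ?thesis using C[OF b] by simp
  qed
  then show ?case by blast
next
  case (NAdd e f)
  then obtain C D where C: "\<And>L s. bounded_state L s \<Longrightarrow> nat_size (nval e s) \<le> C * L \<and> ncost e s \<le> C * L"
    and D: "\<And>L s. bounded_state L s \<Longrightarrow> nat_size (nval f s) \<le> D * L \<and> ncost f s \<le> D * L"
    by blast
  \<comment> \<open>\<open>C + D\<close> pays for the two subexpressions and another
    \<open>C + D\<close> for the size of the new value.\<close>
  have "nat_size (nval (NAdd e f) s) \<le> (2 * C + 2 * D) * L \<and> ncost (NAdd e f) s \<le> (2 * C + 2 * D) * L"
    if b: "bounded_state L s" for L s
    using C[OF b] D[OF b] nat_size_add[of "nval e s" "nval f s"] by (simp add: algebra_simps)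
  then show ?case by blast
next
  case (NSub e f)
  then obtain C D where C: "\<And>L s. bounded_state L s \<Longrightarrow> nat_size (nval e s) \<le> C * L \<and> ncost e s \<le> C * L"
    and D: "\<And>L s. bounded_state L s \<Longrightarrow> nat_size (nval f s) \<le> D * L \<and> ncost f s \<le> D * L"
    by blast
  have "nat_size (nval (NSub e f) s) \<le> (2 * C + 2 * D) * L \<and> ncost (NSub e f) s \<le> (2 * C + 2 * D) * L"
    if b: "bounded_state L s" for L s
    using C[OF b] D[OF b] nat_size_mono[of "nval e s - nval f s" "nval e s"] by (simp add: algebra_simps)
  then show ?case by blast
next
  case (NMul e f)
  then obtain C D where C: "\<And>L s. bounded_state L s \<Longrightarrow> nat_size (nval e s) \<le> C * L \<and> ncost e s \<le> C * L"
    and D: "\<And>L s. bounded_state L s \<Longrightarrow> nat_size (nval f s) \<le> D * L \<and> ncost f s \<le> D * L"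
    by blast
  have "nat_size (nval (NMul e f) s) \<le> (2 * C + 2 * D) * L \<and> ncost (NMul e f) s \<le> (2 * C + 2 * D) * L"
    if b: "bounded_state L s" for L s
    using C[OF b] D[OF b] nat_size_mult[of "nval e s" "nval f s"] by (simp add: algebra_simps)
  then show ?case by blast
qed

lemma rexp_bound:
  "mult_only e \<Longrightarrow>
   \<exists>C. \<forall>L s. bounded_state L s \<longrightarrow> rval e s \<in> Q \<and> sz (rval e s) \<le> C * L \<and> rcost sz e s \<le> C * L"
proof (induction e)
  case RZero
  have "sz 0 \<le> sz 0 * L" if "bounded_state L s" for L s
    using bounded_state_pos[OF that] by simp
  then show ?case using zero_Q by (intro exI[of _ "sz 0"]) auto
next
  case ROne
  have "sz 1 \<le> sz 1 * L" if "bounded_state L s" for L s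
    using bounded_state_pos[OF that] by simp
  then show ?case using one_Q by (intro exI[of _ "sz 1"]) auto
next
  case (RLoad e)
  obtain C where C: "\<And>L s. bounded_state L s \<Longrightarrow> nat_size (nval e s) \<le> C * L \<and> ncost e s \<le> C * L"
    using nexp_bound[of e] by blast
  have "rval (RLoad e) s \<in> Q \<and> sz (rval (RLoad e) s) \<le> (C + 1) * L \<and> rcost sz (RLoad e) s \<le> (C + 1) * L"
    if b: "bounded_state L s" for L s
  proof -
    have "snd s (nval e s) \<in> Q" "sz (snd s (nval e s)) \<le> L" using b by (simp_all add: bounded_state_def)
    then show ?thesis using C[OF b] by simp
  qed
  then show ?case by blast
next
  case (RMul e f)
  then obtain C D where
    C: "\<And>L s. bounded_state L s \<Longrightarrow> rval e s \<in> Q \<and> sz (rval e s) \<le> C * L \<and> rcost sz e s \<le> C * L" and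
    D: "\<And>L s. bounded_state L s \<Longrightarrow> rval f s \<in> Q \<and> sz (rval f s) \<le> D * L \<and> rcost sz f s \<le> D * L"
    by auto
  have "rval (RMul e f) s \<in> Q \<and> sz (rval (RMul e f) s) \<le> (2 * C + 2 * D) * L \<and>
    rcost sz (RMul e f) s \<le> (2 * C + 2 * D) * L"
    if b: "bounded_state L s" for L s
    using C[OF b] D[OF b] sz_mult[of "rval e s" "rval f s"] mult_Q[of "rval e s" "rval f s"]
    by (simp add: algebra_simps)
  then show ?case by blast
qed simp_all

lemma test_bound:
  "mult_only_test b \<Longrightarrow> \<exists>C. \<forall>L s. bounded_state L s \<longrightarrow> tcost sz b s \<le> C * L"
proof (induction b)
  case (NLess e f)
  obtain C D where C: "\<And>L s. bounded_state L s \<Longrightarrow> ncost e s \<le> C * L"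
    and D: "\<And>L s. bounded_state L s \<Longrightarrow> ncost f s \<le> D * L"
    using nexp_bound[of e] nexp_bound[of f] by blast
  then have "tcost sz (NLess e f) s \<le> (C + D + 1) * L" if b: "bounded_state L s" for L s
    using C[OF b] D[OF b] bounded_state_pos[OF b] by (simp add: algebra_simps)
  then show ?case by blast
next
  case (RLess e f)
  then have m: "mult_only e" "mult_only f" by auto
  obtain C D where C: "\<And>L s. bounded_state L s \<Longrightarrow> rcost sz e s \<le> C * L"
    and D: "\<And>L s. bounded_state L s \<Longrightarrow> rcost sz f s \<le> D * L"
    using rexp_bound[OF m(1)] rexp_bound[OF m(2)] by blast
  then have "tcost sz (RLess e f) s \<le> (C + D + 1) * L" if b: "bounded_state L s" for L s
    using C[OF b] D[OF b] bounded_state_pos[OF b] by (simp add: algebra_simps)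
  then show ?case by blast
next
  case (TNot b)
  then obtain C where C: "\<And>L s. bounded_state L s \<Longrightarrow> tcost sz b s \<le> C * L" by auto
  then have "tcost sz (TNot b) s \<le> (C + 1) * L" if b: "bounded_state L s" for L s
    using C[OF b] bounded_state_pos[OF b] by (simp add: algebra_simps)
  then show ?case by blast
next
  case (TAnd b c)
  then obtain C D where C: "\<And>L s. bounded_state L s \<Longrightarrow> tcost sz b s \<le> C * L"
    and D: "\<And>L s. bounded_state L s \<Longrightarrow> tcost sz c s \<le> D * L" by auto
  then have "tcost sz (TAnd b c) s \<le> (C + D + 1) * L" if b: "bounded_state L s" for L s
    using C[OF b] D[OF b] bounded_state_pos[OF b] by (simp add: algebra_simps)
  then show ?case by blast
qed

text \<open>The second part of a sequence starts from a state bounded by \<open>C * L\<close>, so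
  constants multiply. That is harmless for a fixed program text but would be exponential over a
  loop, where the invariant \<open>small\<close> takes over.\<close>

lemma simple_bound:
  "simple p \<Longrightarrow> \<exists>C. \<forall>L s. bounded_state L s \<longrightarrow>
     bounded_state (C * L) (run p s) \<and> (\<exists>t\<le>C * L. exec sz p s t (run p s))"
proof (induction p)
  case Skip
  have "bounded_state L s \<Longrightarrow> \<exists>t\<le>L. exec sz Skip s t s" for L s
    using bounded_state_pos exec.Skip by blast
  then show ?case by (intro exI[of _ 1]) simp
next
  case (NStore a e)
  obtain C where C: "\<And>L s. bounded_state L s \<Longrightarrow> ncost a s \<le> C * L"
    using nexp_bound[of a] by blast
  obtain D where D: "\<And>L s. bounded_state L s \<Longrightarrow> nat_size (nval e s) \<le> D * L \<and> ncost e s \<le> D * L"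
    using nexp_bound[of e] by blast
  have "bounded_state ((C + D + 1) * L) (run (NStore a e) s) \<and>
    (\<exists>t\<le>(C + D + 1) * L. exec sz (NStore a e) s t (run (NStore a e) s))" if b: "bounded_state L s" for L s
  proof
    have "bounded_state ((C + D + 1) * L) s" by (rule bounded_state_mono[OF b]) simp
    moreover have "nat_size (nval e s) \<le> (C + D + 1) * L"
      using D[OF b] by (simp add: algebra_simps)
    ultimately show "bounded_state ((C + D + 1) * L) (run (NStore a e) s)"
      by (simp add: bounded_state_def)
    have "ncost a s + ncost e s + 1 \<le> (C + D + 1) * L"
      using C[OF b] D[OF b] bounded_state_pos[OF b] by (simp add: algebra_simps)
    then show "\<exists>t\<le>(C + D + 1) * L. exec sz (NStore a e) s t (run (NStore a e) s)"
      unfolding run.simps using exec.NStore by blast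
  qed
  then show ?case by blast
next
  case (Seq p q)
  then obtain C D where
    C: "\<And>L s. bounded_state L s \<Longrightarrow> bounded_state (C * L) (run p s) \<and> (\<exists>t\<le>C * L. exec sz p s t (run p s))" and
    D: "\<And>L s. bounded_state L s \<Longrightarrow> bounded_state (D * L) (run q s) \<and> (\<exists>t\<le>D * L. exec sz q s t (run q s))"
    by auto
  have "bounded_state ((C + D * C) * L) (run (Seq p q) s) \<and>
    (\<exists>t\<le>(C + D * C) * L. exec sz (Seq p q) s t (run (Seq p q) s))" if b: "bounded_state L s" for L s
  proof
    have Cb: "bounded_state (C * L) (run p s)" using C[OF b] by blast
    then show "bounded_state ((C + D * C) * L) (run (Seq p q) s)"
      using D[OF Cb] by (auto elim!: bounded_state_mono simp: algebra_simps)
    obtain t u where "t \<le> C * L" "exec sz p s t (run p s)"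
      "u \<le> D * (C * L)" "exec sz q (run p s) u (run q (run p s))"
      using C[OF b] D[OF Cb] by blast
    then show "\<exists>t\<le>(C + D * C) * L. exec sz (Seq p q) s t (run (Seq p q) s)"
      by (intro exI[of _ "t + u"] conjI) (simp add: algebra_simps, auto intro: exec.Seq)
  qed
  then show ?case by blast
next
  case (Cond b p q)
  then obtain C D where
    C: "\<And>L s. bounded_state L s \<Longrightarrow> bounded_state (C * L) (run p s) \<and> (\<exists>t\<le>C * L. exec sz p s t (run p s))" and
    D: "\<And>L s. bounded_state L s \<Longrightarrow> bounded_state (D * L) (run q s) \<and> (\<exists>t\<le>D * L. exec sz q s t (run q s))"
    by auto
  obtain E where E: "\<And>L s. bounded_state L s \<Longrightarrow> tcost sz b s \<le> E * L"
    using test_bound[of b] Cond.prems by auto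
  have "bounded_state ((C + D + E) * L) (run (Cond b p q) s) \<and>
    (\<exists>t\<le>(C + D + E) * L. exec sz (Cond b p q) s t (run (Cond b p q) s))" if bd: "bounded_state L s" for L s
  proof
    show "bounded_state ((C + D + E) * L) (run (Cond b p q) s)"
      using C[OF bd] D[OF bd] by (auto elim!: bounded_state_mono simp: algebra_simps)
    show "\<exists>t\<le>(C + D + E) * L. exec sz (Cond b p q) s t (run (Cond b p q) s)"
    proof (cases "tval b s")
      case True
      obtain t where "t \<le> C * L" "exec sz p s t (run p s)" using C[OF bd] by blast
      then show ?thesis using True E[OF bd]
        by (intro exI[of _ "tcost sz b s + t"] conjI) (simp add: algebra_simps, simp add: exec.CondTrue)
    next
      case False
      obtain t where "t \<le> D * L" "exec sz q s t (run q s)" using D[OF bd] by blast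
      then show ?thesis using False E[OF bd]
        by (intro exI[of _ "tcost sz b s + t"] conjI) (simp add: algebra_simps, simp add: exec.CondFalse)
    qed
  qed
  then show ?case by blast
qed simp_all

end

section \<open>The arithmetic and the bit cost measure\<close>

interpretation unit_cost: size_measure "\<lambda>_. 1" UNIV
  by standard auto

lemma rat_size_of_rat:
  "rat_size (of_rat r) = nat_size (nat \<bar>fst (quotient_of r)\<bar>) + nat_size (nat (snd (quotient_of r)))"
  by (simp add: rat_size_def case_prod_beta)

text \<open>Cancelling the common factor \<open>g\<close> only shrinks numerator and denominator, so
  the lengths of the unreduced products suffice.\<close>

lemma rat_size_mult: "rat_size (of_rat p * of_rat q) \<le> rat_size (of_rat p) + rat_size (of_rat q)"
proof -
  obtain a c where p: "quotient_of p = (a, c)" by (cases "quotient_of p")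
  obtain b d where q: "quotient_of q = (b, d)" by (cases "quotient_of q")
  have pos: "0 < c" "0 < d" using p q quotient_of_denom_pos by blast+
  define g where "g = gcd (a * b) (c * d)"
  have pq: "quotient_of (p * q) = (a * b div g, c * d div g)"
    using pos by (simp add: rat_times_code p q g_def Rat.normalize_def Let_def)
  have g: "1 \<le> g" "g dvd a * b" "g dvd c * d" using pos by (auto simp: g_def int_one_le_iff_zero_less gcd_pos_int)
  have div_le: "\<bar>x div g\<bar> \<le> \<bar>x\<bar>" if "g dvd x" for x
  proof -
    obtain y where y: "x = g * y" using \<open>g dvd x\<close> by (rule dvdE)
    have "1 * \<bar>y\<bar> \<le> g * \<bar>y\<bar>" using g(1) by (intro mult_right_mono) auto
    then show ?thesis using g(1) by (simp add: y abs_mult)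
  qed
  have "nat \<bar>a * b div g\<bar> \<le> nat \<bar>a\<bar> * nat \<bar>b\<bar>"
  proof -
    have "nat \<bar>a * b div g\<bar> \<le> nat (\<bar>a\<bar> * \<bar>b\<bar>)"
      using div_le[OF g(2)] by (intro nat_mono) (simp only: abs_mult)
    then show ?thesis by (simp only: nat_mult_distrib abs_ge_zero)
  qed
  moreover have "nat (c * d div g) \<le> nat c * nat d"
  proof -
    have "c * d div g \<le> \<bar>c * d\<bar>" using div_le[OF g(3)] by linarith
    then have "nat (c * d div g) \<le> nat (c * d)" using pos by (intro nat_mono) simp
    then show ?thesis using pos by (simp only: nat_mult_distrib less_imp_le)
  qed
  ultimately have "rat_size (of_rat (p * q)) \<le> nat_size (nat \<bar>a\<bar> * nat \<bar>b\<bar>) + nat_size (nat c * nat d)"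
    unfolding rat_size_of_rat pq fst_conv snd_conv by (intro add_mono nat_size_mono)
  also have "\<dots> \<le> rat_size (of_rat p) + rat_size (of_rat q)"
    using nat_size_mult[of "nat \<bar>a\<bar>" "nat \<bar>b\<bar>"] nat_size_mult[of "nat c" "nat d"]
    by (simp add: rat_size_of_rat p q)
  finally show ?thesis by (simp add: of_rat_mult)
qed

interpretation bit_cost: size_measure rat_size \<rat>
proof
  show "rat_size (x * y) \<le> rat_size x + rat_size y" if "x \<in> \<rat>" "y \<in> \<rat>" for x y
    using that rat_size_mult by (metis Rats_cases)
  show "1 \<le> rat_size x" for x
    using nat_size_pos by (auto simp: rat_size_def split: prod.split intro: trans_le_add1)
qed auto


section \<open>The program\<close>

abbreviation order_exp :: nexp where "order_exp \<equiv> NLoad (NConst 0)"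
abbreviation pos_exp :: nexp where "pos_exp \<equiv> NLoad (NConst 1)"

text \<open>The entry in row \<open>p + a\<close> and padded column \<open>p + b\<close>. For a column outside the matrix one of the two
  truncated differences in the last factor is positive, so the address is at least \<open>n * n\<close>, where
  the real memory holds 0; the same is true of the address if the row is outside.\<close>

definition entry_exp :: "nat \<Rightarrow> nat \<Rightarrow> nat \<Rightarrow> rexp" where
  "entry_exp K a b = (let i = NAdd pos_exp (NConst a); c = NAdd pos_exp (NConst b) in
     RLoad (NAdd (NAdd (NMul i order_exp) (NSub c (NConst K)))
       (NMul (NMul order_exp order_exp)
         (NAdd (NSub (NAdd c (NConst 1)) (NAdd order_exp (NConst K))) (NSub (NConst K) c)))))"

lemma mult_only_entry_exp: "mult_only (entry_exp K a b)"
  by (simp add: entry_exp_def Let_def)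

lemma rval_entry_exp:
  assumes "square_mat A" "fst s 0 = dim_row A" "snd s = snd (input_state A)"
  shows "rval (entry_exp K a b) s = padded_entry K A (fst s 1 + a) (fst s 1 + b)"
proof -
  define n i c where "n = dim_row A" and "i = fst s 1 + a" and "c = fst s 1 + b"
  define adr where "adr = i * n + (c - K) + n * n * (c + 1 - (n + K) + (K - c))"
  have dims: "dim_row A = n" "dim_col A = n" using assms(1) by (simp_all add: n_def)
  have "rval (entry_exp K a b) s = (if adr < n * n then A $$ (adr div n, adr mod n) else 0)"
    using assms(2,3) by (simp add: entry_exp_def Let_def adr_def input_state_def dims i_def c_def add.commute)
  also have "\<dots> = padded_entry K A i c"
  proof (cases "i < n \<and> K \<le> c \<and> c < n + K")
    case True
    define j where "j = c - K"
    have adr: "adr = i * n + j" and j: "j < n" using True by (auto simp: adr_def j_def)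
    have "adr < Suc i * n" using j by (simp add: adr)
    also have "\<dots> \<le> n * n" using True by (intro mult_le_mono1) simp
    finally have "adr < n * n" .
    moreover have "adr div n = i" "adr mod n = j" using j by (simp_all add: adr)
    ultimately show ?thesis using True by (simp add: padded_entry_def dims j_def)
  next
    case False
    have "n * n \<le> adr"
    proof (cases "i < n")
      case True
      then have "1 \<le> c + 1 - (n + K) + (K - c)" using False by linarith
      then have "n * n * 1 \<le> n * n * (c + 1 - (n + K) + (K - c))" by (intro mult_le_mono2)
      then show ?thesis unfolding adr_def by linarith
    next
      case False
      then have "n * n \<le> i * n" by simp
      then show ?thesis unfolding adr_def by linarith
    qed
    then show ?thesis using False by (auto simp: padded_entry_def dims)
  qed
  finally show ?thesis by (simp add: i_def c_def)
qed

text \<open>A quantifier over a fixed finite set is expanded into program text, which avoids an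
  inner loop.\<close>

definition all_test :: "'b set \<Rightarrow> ('b \<Rightarrow> test) \<Rightarrow> test" where
  "all_test X f = foldr TAnd (map f (list_of X)) (TNot (NLess (NConst 0) (NConst 0)))"

lemma tval_all_test: "finite X \<Longrightarrow> tval (all_test X f) s \<longleftrightarrow> (\<forall>x\<in>X. tval (f x) s)"
proof -
  have "tval (foldr TAnd (map f xs) (TNot (NLess (NConst 0) (NConst 0)))) s \<longleftrightarrow> (\<forall>x\<in>set xs. tval (f x) s)" for xs
    by (induction xs) auto
  then show "finite X \<Longrightarrow> ?thesis" by (simp add: all_test_def set_list_of)
qed

lemma mult_only_all_test: "(\<And>x. mult_only_test (f x)) \<Longrightarrow> mult_only_test (all_test X f)"
proof -
  assume f: "\<And>x. mult_only_test (f x)"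
  have "mult_only_test (foldr TAnd (map f xs) (TNot (NLess (NConst 0) (NConst 0))))" for xs
    by (induction xs) (auto simp: f)
  then show ?thesis by (simp add: all_test_def)
qed

section \<open>The layout of the table in memory\<close>

definition code :: "(nat \<times> nat) set \<Rightarrow> nat" where
  "code S = set_encode (prod_encode ` S)"

definition stride :: "nat \<Rightarrow> nat" where
  "stride K = Suc (Max (code ` Pow (window K)))"

text \<open>The table has one layer of length \<open>stride K\<close> per position. The offset 2
  protects cell 0, which holds the order, and cell 1, which holds the current position.\<close>

definition cell :: "nat \<Rightarrow> nat \<Rightarrow> (nat \<times> nat) set \<Rightarrow> nat" where
  "cell K p S = 2 + code S + stride K * p"

lemma cell_inject:
  assumes "S \<subseteq> window K" "S' \<subseteq> window K"
  shows "cell K p S = cell K p' S' \<longleftrightarrow> p = p' \<and> S = S'"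
proof
  have lt: "code T < stride K" if "T \<subseteq> window K" for T
    using that finite_window[of K] by (auto simp: stride_def less_Suc_eq_le intro!: Max_ge)
  have fin: "finite S" "finite S'" using assms finite_window[of K] by (auto intro: finite_subset)
  assume "cell K p S = cell K p' S'"
  then have eq: "code S + stride K * p = code S' + stride K * p'" by (simp add: cell_def)
  have "p = p'" using arg_cong[OF eq, of "\<lambda>x. x div stride K"] lt[OF assms(1)] lt[OF assms(2)] by simp
  with eq have "set_encode (prod_encode ` S) = set_encode (prod_encode ` S')" by (simp add: code_def)
  then have "prod_encode ` S = prod_encode ` S'" using fin by (simp add: set_encode_eq)
  then show "p = p' \<and> S = S'" using \<open>p = p'\<close> inj_image_eq_iff[OF inj_prod_encode[of UNIV]] by simp
qed simp

definition cell_exp :: "nat \<Rightarrow> nat \<Rightarrow> (nat \<times> nat) set \<Rightarrow> nexp" where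
  "cell_exp K d S = NAdd (NConst (2 + code S)) (NMul (NConst (stride K)) (NAdd pos_exp (NConst d)))"

lemma nval_cell_exp: "nval (cell_exp K d S) s = cell K (fst s 1 + d) S"
  by (simp add: cell_exp_def cell_def)

definition seqs :: "prog list \<Rightarrow> prog" where
  "seqs ps = foldr Seq ps Skip"

lemma run_seqs: "run (seqs ps) s = fold run ps s"
  unfolding seqs_def by (induction ps arbitrary: s) auto

lemma simple_seqs: "(\<And>p. p \<in> set ps \<Longrightarrow> simple p) \<Longrightarrow> simple (seqs ps)"
  unfolding seqs_def by (induction ps) auto

context
  fixes K :: nat and good_test :: "(nat \<times> nat) set \<Rightarrow> test"
begin

definition valid_test :: "(nat \<times> nat) set \<Rightarrow> (nat \<times> nat) set set \<Rightarrow> test" where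
  "valid_test S F = TAnd (all_test F good_test)
     (all_test {b. b \<le> 2 * K \<and> (0, b) \<notin> S \<union> \<Union>F} (\<lambda>b. TNot (RLess RZero (entry_exp K 0 b))))"

text \<open>With truncated subtraction \<open>x - (x - y)\<close> is the minimum of \<open>x\<close> and \<open>y\<close>.\<close>

definition improve :: "(nat \<times> nat) set \<Rightarrow> (nat \<times> nat) set set \<Rightarrow> prog" where
  "improve S F = (let x = NLoad (cell_exp K 0 S);
       y = NAdd (NConst (card F)) (NLoad (cell_exp K 1 (unshift (S \<union> \<Union>F)))) in
     Cond (valid_test S F) (NStore (cell_exp K 0 S) (NSub x (NSub x y))) Skip)"

definition fill_cell :: "(nat \<times> nat) set \<Rightarrow> prog" where
  "fill_cell S = Seq
     (NStore (cell_exp K 0 S) (NAdd (NConst (2 * K + 1)) (NLoad (cell_exp K 1 (unshift S)))))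
     (seqs (map (improve S) (list_of (Pow (Pow (window K))))))"

text \<open>Decrementing before filling makes cell 1 name the topmost finished layer whenever the
  loop test is evaluated.\<close>

definition stage :: prog where
  "stage = Seq (NStore (NConst 1) (NSub pos_exp (NConst 1))) (seqs (map fill_cell (list_of (Pow (window K)))))"

definition loop :: prog where
  "loop = While (NLess (NConst 0) pos_exp) stage"

text \<open>The layer for position \<open>n\<close> needs no initialization: its cells are still 0,
  which is the value of \<open>opt 0\<close>.\<close>

definition solver :: prog where
  "solver = Seq (NStore (NConst 1) order_exp) (Seq loop (NStore (NConst 0) (NLoad (cell_exp K 0 {}))))"

lemma simple_stage:
  assumes "\<And>T. mult_only_test (good_test T)"
  shows "simple stage"
  unfolding stage_def fill_cell_def improve_def valid_test_def Let_def
  by (auto intro!: simple_seqs mult_only_all_test simp: assms mult_only_entry_exp)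

end

section \<open>Correctness and running time of the solver\<close>

locale solver_run = band_cover n K P G for n K P G +
  fixes good_test :: "(nat \<times> nat) set \<Rightarrow> test" and mem :: "nat \<Rightarrow> real"
  assumes good_test: "finite T \<Longrightarrow> fst s 0 = n \<Longrightarrow> snd s = mem \<Longrightarrow>
      tval (good_test T) s \<longleftrightarrow> G (translate (fst s 1) T)"
    and pos_test: "fst s 0 = n \<Longrightarrow> snd s = mem \<Longrightarrow>
      0 < rval (entry_exp K 0 b) s \<longleftrightarrow> (fst s 1, fst s 1 + b) \<in> P"
begin

definition filled :: "nat \<Rightarrow> (nat \<Rightarrow> nat) \<Rightarrow> bool" where
  "filled p m \<longleftrightarrow> m 0 = n \<and> (\<forall>S. S \<subseteq> window K \<longrightarrow> m (cell K p S) = opt (n - p) S)"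

lemma tval_valid_test:
  assumes "F \<subseteq> Pow (window K)" "m 0 = n"
  shows "tval (valid_test K good_test S F) (m, mem) \<longleftrightarrow> valid (m 1) S F"
proof -
  have fin: "finite F" "\<And>T. T \<in> F \<Longrightarrow> finite T"
    using assms(1) finite_window[of K] by (auto intro: finite_subset)
  have "finite {b. b \<le> 2 * K \<and> (0, b) \<notin> S \<union> \<Union>F}" by (rule finite_subset[of _ "{..2 * K}"]) auto
  then show ?thesis
    using good_test[of _ "(m, mem)"] pos_test[of "(m, mem)"] fin assms(2)
    by (simp add: valid_test_def valid_def tval_all_test)
qed

lemma run_improve:
  assumes "Suc p \<le> n" "filled (Suc p) m" "m 1 = p" "S \<subseteq> window K" "F \<subseteq> Pow (window K)"
  shows "run (improve K good_test S F) (m(cell K p S := v), mem) =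
    (m(cell K p S := (if valid p S F then min v (card F + opt (n - Suc p) (unshift (S \<union> \<Union>F))) else v)), mem)"
proof -
  have "unshift (S \<union> \<Union>F) \<subseteq> window K" using assms(4,5) by (intro unshift_window) auto
  moreover have "cell K p S \<noteq> 0" "cell K p S \<noteq> 1" by (simp_all add: cell_def)
  ultimately show ?thesis
    using assms tval_valid_test[of F "m(cell K p S := v)" S]
    by (auto simp: improve_def Let_def nval_cell_exp cell_inject filled_def min_def)
qed

text \<open>Apart from the cell being improved, all table values read belong to layer
  \<open>Suc p\<close>, while the only cell written lies in layer \<open>p\<close>. So the
  improvements act on that cell as the fold in the definition of \<open>opt\<close>.\<close>

lemma run_fill_cell:
  assumes "Suc p \<le> n" "filled (Suc p) m" "m 1 = p" "S \<subseteq> window K"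
  shows "run (fill_cell K good_test S) (m, mem) = (m(cell K p S := opt (n - p) S), mem)"
proof -
  have p: "n - p = Suc (n - Suc p)" "n - Suc (n - Suc p) = p" using assms(1) by auto
  define step where "step F v = (if valid p S F
    then min v (card F + opt (n - Suc p) (unshift (S \<union> \<Union>F))) else v)" for F v
  have fold: "fold run (map (improve K good_test S) Fs) (m(cell K p S := v), mem) =
    (m(cell K p S := fold step Fs v), mem)" if "set Fs \<subseteq> Pow (Pow (window K))" for Fs v
    using that
  proof (induction Fs arbitrary: v)
    case (Cons F Fs)
    have "run (improve K good_test S F) (m(cell K p S := v), mem) = (m(cell K p S := step F v), mem)"
      unfolding step_def using assms Cons.prems by (intro run_improve) auto
    moreover have "fold run (map (improve K good_test S) Fs) (m(cell K p S := step F v), mem) =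
      (m(cell K p S := fold step Fs (step F v)), mem)"
      using Cons.prems by (intro Cons.IH) simp
    ultimately show ?case by (simp only: list.map fold_simps)
  qed simp
  have "m (cell K (Suc p) (unshift S)) = opt (n - Suc p) (unshift S)"
    using assms(2,4) unshift_window by (simp add: filled_def)
  then have "run (fill_cell K good_test S) (m, mem) = fold run (map (improve K good_test S) (list_of (Pow (Pow (window K)))))
    (m(cell K p S := 2 * K + 1 + opt (n - Suc p) (unshift S)), mem)"
    using assms(3) by (simp add: fill_cell_def run_seqs nval_cell_exp)
  also have "\<dots> = (m(cell K p S := fold step (list_of (Pow (Pow (window K)))) (2 * K + 1 + opt (n - Suc p) (unshift S))), mem)"
    by (rule fold) (simp add: set_list_of finite_window)
  also have "fold step (list_of (Pow (Pow (window K)))) (2 * K + 1 + opt (n - Suc p) (unshift S)) = opt (n - p) S"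
    unfolding p(1) opt.simps p(2) step_def[abs_def] ..
  finally show ?thesis .
qed

text \<open>An absolute bound, independent of the number of rounds already done; it makes the time
  bound for the loop body the same in every round.\<close>

definition small :: "(nat \<Rightarrow> nat) \<Rightarrow> bool" where
  "small m \<longleftrightarrow> (\<forall>a. m a \<le> (2 * K + 1) * n)"

lemma run_stage:
  assumes "Suc p \<le> n" "filled (Suc p) m" "small m" "m 1 = Suc p"
  shows "\<exists>m'. run (stage K good_test) (m, mem) = (m', mem) \<and> filled p m' \<and> small m' \<and> m' 1 = p"
proof -
  define m0 where "m0 = m(1 := p)"
  have m0: "filled (Suc p) m0" "small m0" "m0 1 = p"
    using assms by (auto simp: m0_def filled_def small_def cell_def intro: order_trans)
  have "\<exists>m'. fold run (map (fill_cell K good_test) Ss) (m0, mem) = (m', mem) \<and> filled (Suc p) m' \<and>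
      small m' \<and> m' 1 = p \<and> (\<forall>S\<in>set Ss. m' (cell K p S) = opt (n - p) S)"
    if "set Ss \<subseteq> Pow (window K)" for Ss
    using that
  \<comment> \<open>Induction over prefixes keeps the cells already filled in the hypothesis. A
    repeated \<open>S\<close> merely rewrites the same value.\<close>
  proof (induction Ss rule: rev_induct)
    case Nil
    then show ?case using m0 by simp
  next
    case (snoc S Ss)
    then obtain m1 where m1: "fold run (map (fill_cell K good_test) Ss) (m0, mem) = (m1, mem)"
      "filled (Suc p) m1" "small m1" "m1 1 = p" "\<forall>S\<in>set Ss. m1 (cell K p S) = opt (n - p) S" by auto
    have S: "S \<subseteq> window K" using snoc.prems by simp
    define m2 where "m2 = m1(cell K p S := opt (n - p) S)"
    have "run (fill_cell K good_test S) (m1, mem) = (m2, mem)"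
      unfolding m2_def using assms(1) m1(2,4) S by (rule run_fill_cell)
    moreover have "filled (Suc p) m2" using m1(2) S by (auto simp: m2_def filled_def cell_inject) (simp_all add: cell_def)
    moreover have "opt (n - p) S \<le> (2 * K + 1) * n"
      using opt_le[of "n - p" S] mult_le_mono2[of "n - p" n "2 * K + 1"] by linarith
    then have "small m2" using m1(3) by (simp add: small_def m2_def)
    moreover have "m2 1 = p" using m1(4) by (simp add: m2_def cell_def)
    moreover have "\<forall>S'\<in>set (Ss @ [S]). m2 (cell K p S') = opt (n - p) S'"
    proof
      fix S' assume S': "S' \<in> set (Ss @ [S])"
      then have "S' \<subseteq> window K" using snoc.prems by blast
      then show "m2 (cell K p S') = opt (n - p) S'"
        using m1(5) S S' by (auto simp: m2_def cell_inject)
    qed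
    ultimately show ?case using m1(1) by auto
  qed
  from this[of "list_of (Pow (window K))"] obtain m' where
    m': "fold run (map (fill_cell K good_test) (list_of (Pow (window K)))) (m0, mem) = (m', mem)"
      "filled (Suc p) m'" "small m'" "m' 1 = p" "\<forall>S\<in>Pow (window K). m' (cell K p S) = opt (n - p) S"
    by (auto simp: set_list_of finite_window)
  have "run (stage K good_test) (m, mem) = (m', mem)"
    using m'(1) assms(4) by (simp add: stage_def run_seqs m0_def)
  moreover have "filled p m'" using m'(2,5) by (simp add: filled_def)
  ultimately show ?thesis using m'(3,4) by blast
qed

text \<open>Each round costs one test and one body, at most \<open>B\<close> each; the remaining
  \<open>B\<close> is the final failing test.\<close>

lemma exec_loop:
  assumes time: "\<And>m. small m \<Longrightarrow> \<exists>t\<le>B. exec sz (stage K good_test) (m, mem) t (run (stage K good_test) (m, mem))"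
    and test: "\<And>m. small m \<Longrightarrow> tcost sz (NLess (NConst 0) pos_exp) (m, mem) \<le> B"
    and "p \<le> n" "filled p m" "small m" "m 1 = p"
  shows "\<exists>t m'. exec sz (loop K good_test) (m, mem) t (m', mem) \<and> t \<le> B + 2 * B * p \<and>
    filled 0 m' \<and> small m' \<and> m' 1 = 0"
  using assms(3-)
proof (induction p arbitrary: m)
  case 0
  then have "exec sz (loop K good_test) (m, mem) (tcost sz (NLess (NConst 0) pos_exp) (m, mem)) (m, mem)"
    unfolding loop_def by (intro exec.WhileFalse) simp
  then show ?case using test[OF 0(3)] 0 by (intro exI[of _ "tcost sz (NLess (NConst 0) pos_exp) (m, mem)"] exI[of _ m]) simp
next
  case (Suc p)
  obtain m1 where m1: "run (stage K good_test) (m, mem) = (m1, mem)" "filled p m1" "small m1" "m1 1 = p"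
    using run_stage[OF Suc.prems] by blast
  obtain t where t: "t \<le> B" "exec sz (stage K good_test) (m, mem) t (m1, mem)"
    using time[OF Suc.prems(3)] m1(1) by auto
  obtain u m' where u: "exec sz (loop K good_test) (m1, mem) u (m', mem)" "u \<le> B + 2 * B * p"
    "filled 0 m'" "small m'" "m' 1 = 0"
    using Suc.IH[of m1] m1 Suc.prems(1) by auto
  have "tval (NLess (NConst 0) pos_exp) (m, mem)" using Suc.prems(4) by simp
  from exec.WhileTrue[OF this t(2) u(1)[unfolded loop_def]]
  have "exec sz (loop K good_test) (m, mem) (tcost sz (NLess (NConst 0) pos_exp) (m, mem) + t + u) (m', mem)"
    by (simp only: loop_def)
  moreover have "tcost sz (NLess (NConst 0) pos_exp) (m, mem) + t + u \<le> B + 2 * B * Suc p"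
    using test[OF Suc.prems(3)] t(1) u(2) by (simp only: mult_Suc_right)
  ultimately show ?case using u(3-5) by blast
qed

end

text \<open>The constant precedes the order, the entries and \<open>L\<close>, which gives one
  polynomial for all matrices. The factor \<open>n + L + 1\<close> comes from the size of the state,
  \<open>n + 1\<close> from the number of rounds.\<close>

lemma (in size_measure) solver_time:
  assumes "\<And>T. mult_only_test (good_test T)"
  shows "\<exists>C. \<forall>n P G mem L. solver_run n K P G good_test mem \<longrightarrow>
    (\<forall>a. mem a \<in> Q \<and> sz (mem a) \<le> L) \<longrightarrow>
    (\<exists>t s. exec sz (solver K good_test) ((\<lambda>_. 0)(0 := n), mem) t s \<and>
      fst s 0 = band_cover.opt n K P G n {} \<and> t \<le> C * (n + L + 1) * (n + 1))"
proof -
  define first where "first = NStore (NConst 1) order_exp"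
  define final where "final = NStore (NConst 0) (NLoad (cell_exp K 0 {}))"
  obtain C1 where C1: "\<And>L s. bounded_state L s \<Longrightarrow>
      \<exists>t\<le>C1 * L. exec sz (stage K good_test) s t (run (stage K good_test) s)"
    using simple_bound[OF simple_stage[OF assms]] by meson
  obtain C2 where C2: "\<And>L s. bounded_state L s \<Longrightarrow> tcost sz (NLess (NConst 0) pos_exp) s \<le> C2 * L"
    using test_bound[of "NLess (NConst 0) pos_exp"] unfolding mult_only_test.simps by blast
  obtain C3 where C3: "\<And>L s. bounded_state L s \<Longrightarrow> \<exists>t\<le>C3 * L. exec sz first s t (run first s)"
    using simple_bound[of first] unfolding first_def simple.simps by meson
  obtain C4 where C4: "\<And>L s. bounded_state L s \<Longrightarrow> \<exists>t\<le>C4 * L. exec sz final s t (run final s)"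
    using simple_bound[of final] unfolding final_def simple.simps by meson
  define W where "W = 2 * K + 1"
  \<comment> \<open>\<open>C3\<close> and \<open>C4\<close> pay for the first and the last
    assignment. Test and body are each charged at rate \<open>C1 + C2\<close>, and
    \<open>B + 2 * B * n\<close> is at most \<open>2 * B * (n + 1)\<close>.\<close>
  define C where "C = W * (C3 + C4 + 2 * (C1 + C2))"
  have "\<exists>t s. exec sz (solver K good_test) ((\<lambda>_. 0)(0 := n), mem) t s \<and>
      fst s 0 = band_cover.opt n K P G n {} \<and> t \<le> C * (n + L + 1) * (n + 1)"
    if run: "solver_run n K P G good_test mem" and mem: "\<forall>a. mem a \<in> Q \<and> sz (mem a) \<le> L" for n P G mem L
  proof -
    interpret solver_run n K P G good_test mem by (rule run)
    define R where "R = W * (n + L + 1)"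
    have bounded: "bounded_state R (m, mem)" if "small m" for m
    proof -
      have "nat_size (m a) \<le> R" for a
      proof -
        have "nat_size (m a) \<le> Suc (W * n)"
          using nat_size_le_Suc[of "m a"] that by (simp add: small_def W_def) (meson Suc_le_mono order_trans)
        also have "\<dots> \<le> R" by (simp add: R_def W_def algebra_simps)
        finally show ?thesis .
      qed
      moreover have "sz (mem a) \<le> R" for a
      proof -
        have "sz (mem a) \<le> 1 * (n + L + 1)" using mem by (simp add: trans_le_add2 le_SucI)
        also have "\<dots> \<le> R" unfolding R_def by (intro mult_right_mono) (auto simp: W_def)
        finally show ?thesis .
      qed
      ultimately show ?thesis using mem by (simp add: bounded_state_def)
    qed
    define m0 where "m0 = (\<lambda>_ :: nat. 0 :: nat)(0 := n)"
    have "small m0" by (simp add: small_def m0_def)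
    then obtain t1 where t1: "t1 \<le> C3 * R" "exec sz first (m0, mem) t1 (run first (m0, mem))"
      using C3[OF bounded] by blast
    define m1 where "m1 = m0(1 := n)"
    have m1: "run first (m0, mem) = (m1, mem)" by (simp add: first_def m1_def m0_def)
    have "filled n m1" "small m1" "m1 1 = n"
      by (auto simp: filled_def small_def m1_def m0_def cell_def)
    moreover have "\<exists>t\<le>(C1 + C2) * R. exec sz (stage K good_test) (m, mem) t (run (stage K good_test) (m, mem))"
      if m: "small m" for m
    proof -
      obtain t where "t \<le> C1 * R" "exec sz (stage K good_test) (m, mem) t (run (stage K good_test) (m, mem))"
        using C1[OF bounded[OF m]] by blast
      then show ?thesis by (intro exI[of _ t]) (simp add: algebra_simps)
    qed
    moreover have "tcost sz (NLess (NConst 0) pos_exp) (m, mem) \<le> (C1 + C2) * R" if "small m" for m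
      using C2[OF bounded[OF that]] by (simp only: add_mult_distrib)
    ultimately obtain t2 m2 where t2: "exec sz (loop K good_test) (m1, mem) t2 (m2, mem)"
      "t2 \<le> (C1 + C2) * R + 2 * ((C1 + C2) * R) * n" "filled 0 m2" "small m2" "m2 1 = 0"
      using exec_loop[of "(C1 + C2) * R" sz n m1] by blast
    obtain t3 where t3: "t3 \<le> C4 * R" "exec sz final (m2, mem) t3 (run final (m2, mem))"
      using C4[OF bounded[OF t2(4)]] by blast
    have "exec sz (solver K good_test) (m0, mem) (t1 + (t2 + t3)) (run final (m2, mem))"
      unfolding solver_def first_def[symmetric] final_def[symmetric]
      using t1(2)[unfolded m1] t2(1) t3(2) by (intro exec.Seq)
    moreover have "fst (run final (m2, mem)) 0 = opt n {}"
      using t2(3,5) by (simp add: final_def nval_cell_exp filled_def)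
    moreover have "t1 + (t2 + t3) \<le> C * (n + L + 1) * (n + 1)"
    proof -
      have "t1 + (t2 + t3) \<le> (C3 + C4 + 2 * (C1 + C2)) * R * (n + 1)"
        using t1(1) t2(2) t3(1) by (simp add: algebra_simps)
      also have "\<dots> = C * (n + L + 1) * (n + 1)" by (simp only: C_def R_def mult_ac)
      finally show ?thesis .
    qed
    ultimately show ?thesis unfolding m0_def by blast
  qed
  then show ?thesis by blast
qed

lemma band_cover_padded_entry:
  fixes A :: "'a :: selective_semiring mat"
  assumes "A \<in> band_matrices k"
  shows "band_cover (dim_row A) (nat k) (support (padded_entry (nat k) A)) (good (padded_entry (nat k) A))"
proof
  let ?e = "padded_entry (nat k) A"
  fix i c assume "(i, c) \<in> support ?e"
  then have ne: "?e i c \<noteq> 0" by (simp add: support_def)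
  then have ic: "i < dim_row A" "nat k \<le> c" "c < dim_col A + nat k" "A $$ (i, c - nat k) \<noteq> 0"
    by (auto simp: padded_entry_def split: if_splits)
  then have "i < dim_row A" "c - nat k < dim_col A" by auto
  then have le: "\<bar>int i - int (c - nat k)\<bar> \<le> k"
    using assms ic(4) by (fastforce simp: band_matrices_def simp flip: not_less)
  \<comment> \<open>There is a nonzero entry here. For negative \<open>k\<close> the support is
    empty, so replacing \<open>k\<close> by \<open>nat k\<close> does no harm.\<close>
  then have "0 \<le> k" by linarith
  then have "int (nat k) = k" by simp
  moreover have "int (c - nat k) = int c - int (nat k)" using ic(2) by (rule of_nat_diff)
  ultimately show "i < dim_row A \<and> i \<le> c \<and> c \<le> i + 2 * nat k" using ic(1) le by linarith
qed (auto simp: support_def good_singleton good_rectangle elim: goodE)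

text \<open>The test for good sets is specified for an arbitrary entry function in window
  coordinates; \<open>good_translate\<close> carries it to the current row. The assumptions on
  \<open>val\<close> let a sign test decide membership in the support and make the padding read as
  0.\<close>

lemma factorization_rank_poly_time:
  fixes val :: "'a :: selective_semiring \<Rightarrow> real" and k :: int
  defines "K \<equiv> nat k"
  assumes sz: "size_measure sz Q"
    and val: "\<And>x. 0 < val x \<longleftrightarrow> x \<noteq> 0" "val 0 = 0"
    and mult: "\<And>T. mult_only_test (good_test T)"
    and good_test: "\<And>T s e. finite T \<Longrightarrow> (\<And>a b. rval (entry_exp K a b) s = val (e a b)) \<Longrightarrow>
      tval (good_test T) s \<longleftrightarrow> good e T"
    and D: "\<And>A. A \<in> D \<Longrightarrow> A \<in> band_matrices k \<and> elements_mat (map_mat val A) \<subseteq> Q"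
  shows "poly_time sz val D factorization_rank"
proof -
  interpret size_measure sz Q by (rule sz)
  obtain C where C: "\<And>n P G mem L. solver_run n K P G good_test mem \<Longrightarrow>
    \<forall>a. mem a \<in> Q \<and> sz (mem a) \<le> L \<Longrightarrow>
    \<exists>t s. exec sz (solver K good_test) ((\<lambda>_. 0)(0 := n), mem) t s \<and>
      fst s 0 = band_cover.opt n K P G n {} \<and> t \<le> C * (n + L + 1) * (n + 1)"
    using solver_time[of good_test K, OF mult] by blast
  \<comment> \<open>For input size \<open>x\<close> this is
    \<open>C * (2 * x + sz 0 + 1) * (x + 1)\<close>, since the order is at most \<open>x\<close> and
    each real cell has size at most \<open>x + sz 0\<close>; the term \<open>sz 0\<close> accounts
    for cells outside the input.\<close>
  define q :: "nat poly" where "q = [:C:] * [:sz 0 + 1, 2:] * [:1, 1:]"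
  have "\<exists>t s. exec sz (solver K good_test) (input_state (map_mat val A)) t s \<and>
    fst s 0 = factorization_rank A \<and> t \<le> poly q (mat_size sz (map_mat val A))" if "A \<in> D" for A
  proof -
    define M where "M = map_mat val A"
    define n where "n = dim_row A"
    define mem where "mem = snd (input_state M)"
    define e where "e = padded_entry K A"
    have A: "A \<in> band_matrices k" "elements_mat M \<subseteq> Q" using D[OF that] by (auto simp: M_def)
    then have sq: "square_mat A" "dim_row A = n" "dim_col A = n" by (auto simp: band_matrices_def n_def)
    then have M: "square_mat M" "dim_row M = n" "dim_col M = n" by (auto simp: M_def)
    have entry: "rval (entry_exp K a b) s = val (e (fst s 1 + a) (fst s 1 + b))"
      if "fst s 0 = n" "snd s = mem" for s a b
    proof -
      have "rval (entry_exp K a b) s = padded_entry K M (fst s 1 + a) (fst s 1 + b)"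
        using that M by (intro rval_entry_exp) (auto simp: mem_def)
      also have "\<dots> = val (e (fst s 1 + a) (fst s 1 + b))"
        using sq M by (auto simp: e_def padded_entry_def M_def val(2))
      finally show ?thesis .
    qed
    have "band_cover n K (support e) (good e)"
      unfolding n_def K_def e_def using A(1) by (rule band_cover_padded_entry)
    then interpret solver_run n K "support e" "good e" good_test mem
    proof (intro solver_run.intro solver_run_axioms.intro)
      show "tval (good_test T) s \<longleftrightarrow> good e (translate (fst s 1) T)"
        if "finite T" "fst s 0 = n" "snd s = mem" for T s
        unfolding good_translate using that entry by (intro good_test) auto
      show "0 < rval (entry_exp K 0 b) s \<longleftrightarrow> (fst s 1, fst s 1 + b) \<in> support e"
        if "fst s 0 = n" "snd s = mem" for s b
        using entry[OF that, of 0 b] by (simp add: val(1) support_def)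
    qed
    have sz_le: "sz (M $$ (i, j)) \<le> mat_size sz M" if "i < n" "j < n" for i j
    proof -
      have "sz (M $$ (i, j)) \<le> (\<Sum>j<n. sz (M $$ (i, j)))"
        using that by (intro member_le_sum) auto
      also have "\<dots> \<le> mat_size sz M"
        unfolding mat_size_def M using that by (intro member_le_sum[of i _ "\<lambda>i. \<Sum>j<n. sz (M $$ (i, j))"]) auto
      finally show ?thesis .
    qed
    have mem: "\<forall>a. mem a \<in> Q \<and> sz (mem a) \<le> mat_size sz M + sz 0"
    proof
      fix a
      show "mem a \<in> Q \<and> sz (mem a) \<le> mat_size sz M + sz 0"
      proof (cases "a < n * n")
        case True
        then have a: "a div n < n" "a mod n < n"
          by (auto simp: less_mult_imp_div_less intro!: mod_less_divisor gr0I)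
        have "mem a = M $$ (a div n, a mod n)" using True by (simp add: mem_def input_state_def Let_def M)
        moreover have "M $$ (a div n, a mod n) \<in> Q"
          using A(2) a M by (blast intro: elements_matI carrier_matI)
        ultimately show ?thesis using sz_le[OF a] by simp
      next
        case False
        then have "mem a = 0" by (simp add: mem_def input_state_def Let_def M)
        then show ?thesis using zero_Q by simp
      qed
    qed
    \<comment> \<open>Every entry has size at least 1, so the input size is at least
      \<open>n * n\<close>.\<close>
    have n_le: "n \<le> mat_size sz M"
    proof -
      have "n * n = (\<Sum>i<n. \<Sum>j<n. 1)" by simp
      also have "\<dots> \<le> mat_size sz M" unfolding mat_size_def M by (intro sum_mono sz_pos)
      finally show ?thesis using le_square[of n] by (rule order_trans[rotated])
    qed
    obtain t s where ts: "exec sz (solver K good_test) ((\<lambda>_. 0)(0 := n), mem) t s"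
      "fst s 0 = opt n {}" "t \<le> C * (n + (mat_size sz M + sz 0) + 1) * (n + 1)"
      using C[OF solver_run_axioms mem] by blast
    have "input_state M = ((\<lambda>_. 0)(0 := n), mem)" by (simp add: mem_def input_state_def Let_def M)
    moreover have "opt n {} = factorization_rank A"
      unfolding opt_eq_Least factorization_rank_eq_cover[of A K] by (simp add: good_cover_def e_def)
    moreover have "t \<le> poly q (mat_size sz M)"
    proof -
      have "t \<le> C * (mat_size sz M + (mat_size sz M + sz 0) + 1) * (mat_size sz M + 1)"
        using n_le by (intro order_trans[OF ts(3)] mult_mono) auto
      also have "\<dots> = poly q (mat_size sz M)" by (simp add: q_def algebra_simps)
      finally show ?thesis .
    qed
    ultimately show ?thesis
      using ts(1,2) by (intro exI[of _ t] exI[of _ s]) (simp add: M_def)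
  qed
  then show ?thesis unfolding poly_time_def by blast
qed


section \<open>Tests for good sets\<close>

definition pos_set_test :: "nat \<Rightarrow> (nat \<times> nat) set \<Rightarrow> test" where
  "pos_set_test K T = all_test T (\<lambda>x. RLess RZero (entry_exp K (fst x) (snd x)))"

definition fuzzy_test :: "nat \<Rightarrow> (nat \<times> nat) set \<Rightarrow> test" where
  "fuzzy_test K T = TAnd (pos_set_test K T) (all_test T (\<lambda>x. all_test T (\<lambda>y.
     TNot (TAnd (RLess (entry_exp K (fst x) (snd y)) (entry_exp K (fst x) (snd x)))
       (RLess (entry_exp K (fst x) (snd y)) (entry_exp K (fst y) (snd y)))))))"

fun walk_exp :: "('b \<Rightarrow> 'b \<Rightarrow> rexp) \<Rightarrow> 'b list \<Rightarrow> rexp" where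
  "walk_exp w (x # y # zs) = RMul (w x y) (walk_exp w (y # zs))"
| "walk_exp w _ = ROne"

lemma rval_walk_exp: "rval (walk_exp w xs) s = walk (\<lambda>x y. rval (w x y) s) xs"
  by (induction w xs rule: walk_exp.induct) auto

lemma mult_only_walk_exp: "(\<And>x y. mult_only (w x y)) \<Longrightarrow> mult_only (walk_exp w xs)"
  by (induction w xs rule: walk_exp.induct) auto

definition prod_exp :: "rexp list \<Rightarrow> rexp" where
  "prod_exp es = foldr RMul es ROne"

lemma rval_prod_exp: "rval (prod_exp es) s = prod_list (map (\<lambda>e. rval e s) es)"
  unfolding prod_exp_def by (induction es) auto

lemma mult_only_prod_exp: "(\<And>e. e \<in> set es \<Longrightarrow> mult_only e) \<Longrightarrow> mult_only (prod_exp es)"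
  unfolding prod_exp_def by (induction es) auto

text \<open>Every simple cycle in \<open>T\<close> is listed by its vertices and closed by repeating
  its head. Comparing the two products avoids division, and there are finitely many distinct lists
  to expand.\<close>

definition tropical_test :: "nat \<Rightarrow> (nat \<times> nat) set \<Rightarrow> test" where
  "tropical_test K T = TAnd (pos_set_test K T)
     (all_test {xs. xs \<noteq> [] \<and> distinct xs \<and> set xs \<subseteq> T} (\<lambda>xs.
       TNot (RLess (walk_exp (\<lambda>x y. entry_exp K (fst x) (snd y)) (xs @ [hd xs]))
         (prod_exp (map (\<lambda>x. entry_exp K (fst x) (snd x)) xs)))))"

lemma mult_only_fuzzy_test: "mult_only_test (fuzzy_test K T)"
  unfolding fuzzy_test_def pos_set_test_def
  by (simp add: mult_only_all_test mult_only_entry_exp)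

lemma mult_only_tropical_test: "mult_only_test (tropical_test K T)"
  unfolding tropical_test_def pos_set_test_def
  by (auto intro!: mult_only_all_test mult_only_walk_exp mult_only_prod_exp simp: mult_only_entry_exp)

lemma tval_fuzzy_test:
  assumes "finite T" "\<And>a b. rval (entry_exp K a b) s = fuzzy_val (e a b)"
  shows "tval (fuzzy_test K T) s \<longleftrightarrow> good e T"
  unfolding good_fuzzy_iff[OF assms(1)]
  by (simp add: fuzzy_test_def pos_set_test_def tval_all_test assms)

lemma tval_tropical_test:
  assumes "finite T" "\<And>a b. rval (entry_exp K a b) s = tropical_val (e a b)"
  shows "tval (tropical_test K T) s \<longleftrightarrow> good e T"
proof -
  have "finite {xs. xs \<noteq> [] \<and> distinct xs \<and> set xs \<subseteq> T}"
    by (rule finite_subset[OF _ finite_distinct_lists[OF assms(1)]]) auto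
  then have "tval (tropical_test K T) s \<longleftrightarrow> (\<forall>x\<in>T. 0 < tropical_val (e (fst x) (snd x))) \<and>
    (\<forall>xs. xs \<noteq> [] \<and> distinct xs \<and> set xs \<subseteq> T \<longrightarrow>
      prod_list (map (\<lambda>x. tropical_val (e (fst x) (snd x))) xs) \<le>
      walk (\<lambda>x y. tropical_val (e (fst x) (snd y))) (xs @ [hd xs]))"
    by (simp add: tropical_test_def pos_set_test_def tval_all_test assms rval_walk_exp rval_prod_exp o_def not_less)
  also have "\<dots> \<longleftrightarrow> good e T"
  proof -
    have "(\<forall>xs. xs \<noteq> [] \<and> Q xs \<longrightarrow> R xs) \<longleftrightarrow> (\<forall>x xs. Q (x # xs) \<longrightarrow> R (x # xs))"
      for Q R :: "(nat \<times> nat) list \<Rightarrow> bool"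
      by (auto simp: neq_Nil_conv)
    then show ?thesis
      unfolding good_tropical_iff[OF assms(1)] by (simp only: append_Cons list.sel(1) imp_conjL)
  qed
  finally show ?thesis .
qed

theorem theorem3p4:
  fixes k :: int
  shows
    "poly_time_arith fuzzy_val (band_matrices k) factorization_rank \<and>
     poly_time_bit fuzzy_val (band_matrices k) factorization_rank \<and>
     poly_time_arith tropical_val (band_matrices k) factorization_rank \<and>
     poly_time_bit tropical_val (band_matrices k) factorization_rank"
proof -
  have fuzzy: "poly_time sz fuzzy_val D factorization_rank"
    if "size_measure sz Q" "\<And>A. A \<in> D \<Longrightarrow> A \<in> band_matrices k \<and> elements_mat (map_mat fuzzy_val A) \<subseteq> Q"
    for sz Q D
    by (rule factorization_rank_poly_time[OF that(1) fuzzy_val_pos zero_fuzzy.rep_eq mult_only_fuzzy_test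
      tval_fuzzy_test that(2)])
  have tropical: "poly_time sz tropical_val D factorization_rank"
    if "size_measure sz Q" "\<And>A. A \<in> D \<Longrightarrow> A \<in> band_matrices k \<and> elements_mat (map_mat tropical_val A) \<subseteq> Q"
    for sz Q D
    by (rule factorization_rank_poly_time[OF that(1) tropical_val_pos zero_tropical.rep_eq mult_only_tropical_test
      tval_tropical_test that(2)])
  show ?thesis
    unfolding poly_time_arith_def poly_time_bit_def
    by (intro conjI fuzzy[OF unit_cost.size_measure_axioms] fuzzy[OF bit_cost.size_measure_axioms]
      tropical[OF unit_cost.size_measure_axioms] tropical[OF bit_cost.size_measure_axioms]) auto
qed

end
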